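(* Let $r\geq 2$ and $n,m\geq 1$ be integers and let $p\in[1,2]$. For every function $f:\mathbb{Z}_r^n\to\mathbb{C}^{m\times m}$ and every $\rho\geq 0$ with \[ \rho\leq\sqrt{\frac{(p-1)(1-(p-1)^{r-1})}{(r-1)(2-p)}}, \] we have \[ \left(\sum_{S\in\mathbb{Z}_r^n}\rho^{2|S|}\|\widehat f(S)\|_p^2\right)^{1/2}\leq\left(\frac{1}{r^n}\sum_{x\in\mathbb{Z}_r^n}\|f(x)\|_p^p\right)^{1/p}. \]
   Context: $\mathbb{Z}_r=\{0,\ldots,r-1\}$ with arithmetic mod $r$, $\omega_r=e^{2\pi i/r}$. For $S\in\mathbb{Z}_r^n$, $|S|=|\{i\in[n]:S_i\neq 0\}|$ and $S\cdot x=\sum_i S_ix_i$ computed in $\mathbb{Z}_r$. The Fourier coefficients are $\widehat f(S)=\frac{1}{r^n}\sum_{x\in\mathbb{Z}_r^n}f(x)\omega_r^{-S\cdot x}\in\mathbb{C}^{m\times m}$. $\|M\|_p=(\sum_i\sigma_i(M)^p)^{1/p}$ is the unnormalized Schatten $p$-norm ($\sigma_i(M)$ the singular values). At $p=2$ the bound on $\rho$ is understood via the limit value $1$ of the expression under the square root. *)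

theory Defs
  imports
    Complex_Main
    "HOL-Library.FuncSet"
    "HOL-Library.Multiset"
    "HOL-Computational_Algebra.Polynomial"
    "Jordan_Normal_Form.Schur_Decomposition"
begin

text \<open>The singular values are the square roots of the eigenvalues of the positive semidefinite
  matrix M* M, taken with algebraic multiplicity. These eigenvalues are real and nonnegative, so
  \<^term>\<open>Re\<close> only changes the type.\<close>

definition singular_values :: "complex mat \<Rightarrow> real multiset" where
  "singular_values M = image_mset (\<lambda>z. sqrt (Re z)) (proots (char_poly (mat_adjoint M * M)))"

definition schatten_norm :: "real \<Rightarrow> complex mat \<Rightarrow> real" where
  "schatten_norm p M = (\<Sum>s\<in>#singular_values M. s powr p) powr (1 / p)"

text \<open>Elements of the n-th power of Z_r are the functions from \<open>{..<n}\<close> to \<open>{..<r}\<close>,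
  extensional so that each element has exactly one representative.\<close>

definition Zr_power :: "nat \<Rightarrow> nat \<Rightarrow> (nat \<Rightarrow> nat) set" where
  "Zr_power r n = {..<n} \<rightarrow>\<^sub>E {..<r}"

definition supp_size :: "nat \<Rightarrow> (nat \<Rightarrow> nat) \<Rightarrow> nat" where
  "supp_size n S = card {i \<in> {..<n}. S i \<noteq> 0}"

definition Zr_dot :: "nat \<Rightarrow> nat \<Rightarrow> (nat \<Rightarrow> nat) \<Rightarrow> (nat \<Rightarrow> nat) \<Rightarrow> nat" where
  "Zr_dot r n S x = (\<Sum>i<n. S i * x i) mod r"

definition omega :: "nat \<Rightarrow> complex" where
  "omega r = exp (2 * of_real pi * \<i> / of_nat r)"

text \<open>The sum of matrices is written out entrywise because the type \<^typ>\<open>complex mat\<close>,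
  which contains matrices of all dimensions, has no zero and hence no \<^const>\<open>sum\<close>.\<close>

definition fourier_coeff ::
  "nat \<Rightarrow> nat \<Rightarrow> nat \<Rightarrow> ((nat \<Rightarrow> nat) \<Rightarrow> complex mat) \<Rightarrow> (nat \<Rightarrow> nat) \<Rightarrow> complex mat" where
  "fourier_coeff r n m f S = mat m m (\<lambda>(i, j).
     1 / of_nat r ^ n *
       (\<Sum>x\<in>Zr_power r n. f x $$ (i, j) * omega r powi (- int (Zr_dot r n S x))))"

text \<open>At \<open>p = 2\<close> the quotient under the square root is 0/0; its limit there is 1.\<close>

definition rho_bound :: "nat \<Rightarrow> real \<Rightarrow> real" where
  "rho_bound r p = sqrt (if p = 2 then 1
     else (p - 1) * (1 - (p - 1) ^ (r - 1)) / ((real r - 1) * (2 - p)))"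

end

theory Submission
  imports Defs "HOL-Analysis.Analysis" "Jordan_Normal_Form.Spectral_Radius"
begin

text \<open>The core is a sharp 2-uniform convexity inequality of Ball, Carlen and Lieb type for the
  normalised \<open>p\<close>-norm \<open>N\<close> of matrix-valued functions: if \<open>A\<close> is the average of \<open>F\<close> over one coordinate,
  then \<open>N(A)\<^sup>2 + (p - 1) N(F - A)\<^sup>2 \<le> N(F)\<^sup>2\<close>. Since \<open>A\<close> kills the first-order term, it suffices to
  bound below the Bregman divergence of \<open>tr \<bar>X\<bar> powr p\<close>. Klein's argument reduces this divergence to
  scalar ones, which leaves a quadratic form in \<open>B = F - A\<close> with weights \<open>(d\<^sub>i + e\<^sub>j) powr (- s)\<close>,
  \<open>s = 2 / p - 1\<close>. Writing the power as an integral of resolvents replaces these weights by their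
  diagonal with respect to the singular vectors of \<open>B\<close>, and Hoelder's inequality finishes the bound.

  Multiplying \<open>F\<close> by a character first, the inequality splits off one Fourier coefficient at a time;
  iterating gives the successive frequencies the factors \<open>1, p - 1, (p - 1)\<^sup>2, ...\<close>, and averaging over
  the order of the nonzero frequencies gives the one-coordinate theorem. As all inequalities hold
  for functions of further variables, the theorem follows by induction on \<open>n\<close>.\<close>

section \<open>Scalar inequalities\<close>

text \<open>The obstacle is that the matrices X and Y to be compared need not commute: scalar
  inequalities hold only for pairs of eigenvalues, which produces weights indexed by two different
  eigenbases. The weight is therefore chosen as a sum of one term in each eigenvalue. Such a weight
  is diagonal on the singular vectors of B, and its diagonal adds up to a trace. Both terms are p-th
  powers, so this trace is a combination of the two quantities that enter the final inequality. The
  exponent is dictated by \<open>p * s = 2 - p\<close>: the power - s of a p-th power is the power p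
  - 2 of the second derivative. No constant is lost on the way. The factor p (p - 1) / 2 comes from
  Taylor's formula, Hoelder's inequality adds none, and passing from p-th powers to squares of norms
  contributes the derivative factor 1 + s = 2 / p; the product is p - 1. Bregman divergences replace
  the usual symmetric pairs X + Y, X - Y because A is a mean of r values and not a midpoint.\<close>

lemma powr_neg_ge_tangent:
  fixes v a :: real
  assumes "0 < v" "0 \<le> a"
  shows "(1 + a) - a * v \<le> v powr (- a)"
proof -
  have "ln v \<le> v - 1" using assms ln_le_minus_one by auto
  then have "1 + a * (1 - v) \<le> 1 + (- a) * ln v"
    using mult_left_mono[of "ln v" "v - 1" a] assms by (simp add: algebra_simps)
  also have "\<dots> \<le> exp ((- a) * ln v)" by (rule exp_ge_add_one_self)
  finally show ?thesis using assms by (simp add: powr_def algebra_simps)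
qed

text \<open>The left side is the tangent line of \<open>u powr (- a)\<close> at z, evaluated at x.
  Being affine in x, it averages to \<open>z powr (- a)\<close> whenever the mean of x is z.\<close>

lemma powr_neg_ge:
  fixes x z a :: real
  assumes "0 < x" "0 < z" "0 \<le> a"
  shows "z powr (- a) * ((1 + a) - a * (x / z)) \<le> x powr (- a)"
proof -
  have "z powr (- a) * ((1 + a) - a * (x / z)) \<le> z powr (- a) * (x / z) powr (- a)"
    using powr_neg_ge_tangent[of "x / z" a] assms by (intro mult_left_mono) auto
  also have "\<dots> = x powr (- a)"
    using assms by (simp add: powr_mult[symmetric])
  finally show ?thesis .
qed

text \<open>With a = 2 - p the constant p (p - 1) / 2 factors as (1 - a) (1 - a / 2). The bases 2, 3
  / 2 and their product 3 are the multiples of z at which \<open>bregman_powr_neg\<close> takes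
  tangents.\<close>

lemma two_powr_neg_ge: "0 \<le> a \<Longrightarrow> 1 - a \<le> 2 powr (- a :: real)"
  using powr_neg_ge_tangent[of 2 a] by simp

lemma three_halves_powr_neg_ge: "0 \<le> a \<Longrightarrow> 1 - a / 2 \<le> (3 / 2) powr (- a :: real)"
  using powr_neg_ge_tangent[of "3/2" a] by simp

lemma three_powr_neg_ge:
  assumes "0 \<le> a" "a \<le> 1"
  shows "(1 - a) * (1 - a / 2) \<le> 3 powr (- a :: real)"
proof -
  have "(1 - a) * (1 - a / 2) \<le> 2 powr (- a) * (3 / 2) powr (- a)"
    using assms two_powr_neg_ge three_halves_powr_neg_ge by (intro mult_mono) auto
  also have "\<dots> = 3 powr (- a)" by (simp add: powr_mult[symmetric])
  finally show ?thesis .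
qed


text \<open>This is the tangent at \<kappa> z with its height lowered to
  \<open>k * z powr (- a)\<close>. Lowering is legitimate where the affine factor is nonnegative;
  elsewhere the left side is at most 0.\<close>

lemma scaled_powr_neg_ge:
  fixes x z a \<kappa> k :: real
  assumes "0 < x" "0 < z" "0 \<le> a" "0 < \<kappa>" "0 \<le> k" "k \<le> \<kappa> powr (- a)"
  shows "k * z powr (- a) * ((1 + a) - a * x / (\<kappa> * z)) \<le> x powr (- a)"
proof (cases "0 \<le> (1 + a) - a * x / (\<kappa> * z)")
  case True
  have "k * z powr (- a) * ((1 + a) - a * x / (\<kappa> * z))
      \<le> \<kappa> powr (- a) * z powr (- a) * ((1 + a) - a * x / (\<kappa> * z))"
    using assms True by (intro mult_right_mono) auto
  also have "\<dots> = (\<kappa> * z) powr (- a) * ((1 + a) - a * (x / (\<kappa> * z)))"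
    using assms by (simp add: powr_mult)
  also have "\<dots> \<le> x powr (- a)"
    using powr_neg_ge[of x "\<kappa> * z" a] assms by simp
  finally show ?thesis .
next
  case False
  have "k * z powr (- a) * ((1 + a) - a * x / (\<kappa> * z)) \<le> 0"
    using False assms by (intro mult_nonneg_nonpos) auto
  then show ?thesis by (rule order_trans) simp
qed

section \<open>The scalar Bregman divergence of \<open>\<bar>u\<bar> powr p\<close>\<close>

text \<open>The second derivative p (p - 1) \<open>u powr (p - 2)\<close> lies above its tangent
  line at z, and integrating that line twice from x to y leaves only its value at z.\<close>

lemma bregman_powr_pos:
  fixes p x y :: real
  assumes p: "1 \<le> p" "p \<le> 2" and xy: "0 < x" "0 < y"
  shows "p * (p - 1) / 2 * (y - x)\<^sup>2 * ((2 * x + y) / 3) powr (p - 2)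
    \<le> y powr p - x powr p - p * x powr (p - 1) * (y - x)"
proof -
  define a where "a = 2 - p"
  define z where "z = (2 * x + y) / 3"
  define k where "k = p * (p - 1) * z powr (- a)"
  have z: "0 < z" using xy by (simp add: z_def)
  have a: "0 \<le> a" using p by (simp add: a_def)
  \<comment> \<open>The subtracted polynomial has second derivative
    \<open>k * ((1 + a) - a * u / z)\<close>, so \<open>G''\<close> is nonnegative by the tangent
    bound and \<open>G\<close> is convex on the positive axis.\<close>
  define G where "G u = u powr p - k * ((1 + a) * u\<^sup>2 / 2 - a * u ^ 3 / (6 * z))" for u
  define G' where "G' u = p * u powr (p - 1) - k * ((1 + a) * u - a * u\<^sup>2 / (2 * z))" for u
  define G'' where "G'' u = p * (p - 1) * u powr (- a) - k * ((1 + a) - a * u / z)" for u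
  have d1: "(G has_real_derivative G' u) (at u)" if "u \<in> {0<..}" for u
    unfolding G_def G'_def using that z
    by (auto intro!: derivative_eq_intros simp: field_simps power2_eq_square)
  have d2: "(G' has_real_derivative G'' u) (at u)" if "u \<in> {0<..}" for u
    unfolding G'_def G''_def using that z
    by (auto intro!: derivative_eq_intros simp: field_simps a_def)
  have d2_ge: "0 \<le> G'' u" if "u \<in> {0<..}" for u
  proof -
    have "p * (p - 1) * (z powr (- a) * ((1 + a) - a * (u / z))) \<le> p * (p - 1) * u powr (- a)"
      using powr_neg_ge[of u z a] that z a p by (intro mult_left_mono) auto
    then show ?thesis by (simp add: G''_def k_def mult.assoc)
  qed
  have "convex_on {0<..} G"
    using d1 d2 d2_ge by (intro f''_ge0_imp_convex) auto
  then have "G' x * (y - x) \<le> G y - G x"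
    using d1[of x] xy
    by (intro convex_on_imp_above_tangent[of "{0<..}"])
       (auto simp: interior_open intro: has_field_derivative_at_within)
  then have "k * ((1 + a) * (y\<^sup>2 - x\<^sup>2) / 2 - a * (y ^ 3 - x ^ 3) / (6 * z)
        - ((1 + a) * x - a * x\<^sup>2 / (2 * z)) * (y - x))
      \<le> y powr p - x powr p - p * x powr (p - 1) * (y - x)"
    by (simp add: G_def G'_def algebra_simps diff_divide_distrib)
  also have "(1 + a) * (y\<^sup>2 - x\<^sup>2) / 2 - a * (y ^ 3 - x ^ 3) / (6 * z)
        - ((1 + a) * x - a * x\<^sup>2 / (2 * z)) * (y - x)
      = (1 + a) * (y - x)\<^sup>2 / 2 - a * ((y - x)\<^sup>2 * (y + 2 * x)) / (6 * z)"
    using z by (simp add: field_simps power2_eq_square power3_eq_cube)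
  \<comment> \<open>With this choice of z the divergence of the cubic polynomial collapses to (y -
    x)^2 / 2.\<close>
  also have "y + 2 * x = 3 * z" by (simp add: z_def)
  also have "(1 + a) * (y - x)\<^sup>2 / 2 - a * ((y - x)\<^sup>2 * (3 * z)) / (6 * z) = (y - x)\<^sup>2 / 2"
    using z by (simp add: field_simps)
  finally show ?thesis by (simp add: k_def z_def a_def mult_ac)
qed

lemma powr_minus_split:
  fixes x p :: real
  assumes "0 \<le> x"
  shows "x powr p = x\<^sup>2 * x powr (p - 2)" "x powr (p - 1) = x * x powr (p - 2)"
proof -
  have "x powr p = x powr 2 * x powr (p - 2)" "x powr (p - 1) = x powr 1 * x powr (p - 2)"
    by (subst powr_add[symmetric], simp)+
  moreover have "x powr 1 = x" "x powr 2 = x\<^sup>2"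
    using assms by simp_all
  ultimately show "x powr p = x\<^sup>2 * x powr (p - 2)" "x powr (p - 1) = x * x powr (p - 2)"
    by metis+
qed

text \<open>The right side is the divergence from x to y = - w. This segment crosses 0, where the
  power is not twice differentiable for p < 2, so tangents are applied to the powers themselves: to
  those of w at 3 z, of x in \<open>x powr p\<close> at 3 z / 2 and of x in the mixed term at 2 z.
  With these multiples each term acquires the factor (1 - a) (1 - a / 2), and the leading parts
  assemble to w^2 + x^2 + 2 x w = (x + w)^2.\<close>

lemma bregman_powr_neg:
  fixes p x w :: real
  assumes p: "1 \<le> p" "p \<le> 2" and x: "0 < x" and w: "0 \<le> w"
  shows "p * (p - 1) / 2 * (x + w)\<^sup>2 * ((2 * x + w) / 3) powr (p - 2)
    \<le> w powr p + (p - 1) * x powr p + p * x powr (p - 1) * w"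
proof -
  define a where "a = 2 - p"
  define z where "z = (2 * x + w) / 3"
  define k where "k = z powr (- a)"
  have pa: "p - 2 = - a" and p_eq: "p = 2 - a" and p1: "p - 1 = 1 - a" by (simp_all add: a_def)
  have z: "0 < z" using x w by (simp add: z_def)
  have a: "0 \<le> a" "a \<le> 1" using p by (simp_all add: a_def)
  have k: "0 \<le> k" by (simp add: k_def)
  have 1: "(1 - a / 2) * k * ((1 + a) - a * x / (3 / 2 * z)) \<le> x powr (- a)"
    unfolding k_def
    by (intro scaled_powr_neg_ge) (use x z a three_halves_powr_neg_ge in auto)
  have 2: "(1 - a) * k * ((1 + a) - a * x / (2 * z)) \<le> x powr (- a)"
    unfolding k_def
    by (intro scaled_powr_neg_ge) (use x z a two_powr_neg_ge in auto)
  have 3: "w\<^sup>2 * ((1 - a) * (1 - a / 2) * k * ((1 + a) - a * w / (3 * z))) \<le> w\<^sup>2 * w powr (- a)"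
  proof (cases "w = 0")
    case False
    then show ?thesis unfolding k_def
      by (intro mult_left_mono scaled_powr_neg_ge) (use w z a three_powr_neg_ge in auto)
  qed simp
  have c: "p * (p - 1) / 2 = (1 - a) * (1 - a / 2)" by (simp add: a_def field_simps)
  \<comment> \<open>The left side collects the linear parts of the three tangents. As 3 z = 2 x + w,
    the two sides differ by 2 x^2 w + 4 x w^2.\<close>
  have "w ^ 3 + 2 * x ^ 3 + 3 * x\<^sup>2 * w \<le> (x + w)\<^sup>2 * (3 * z)"
    using x w by (simp add: z_def power2_eq_square power3_eq_cube algebra_simps)
  then have "a * (w ^ 3 + 2 * x ^ 3 + 3 * x\<^sup>2 * w) \<le> a * ((x + w)\<^sup>2 * (3 * z))"
    using a by (intro mult_left_mono)
  then have "a * (w ^ 3 + 2 * x ^ 3 + 3 * x\<^sup>2 * w) / (3 * z) \<le> a * (x + w)\<^sup>2"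
    using z by (simp add: divide_le_eq algebra_simps)
  then have "(x + w)\<^sup>2 \<le> (1 + a) * (x + w)\<^sup>2 - a * (w ^ 3 + 2 * x ^ 3 + 3 * x\<^sup>2 * w) / (3 * z)"
    by (simp add: algebra_simps)
  then have "p * (p - 1) / 2 * (x + w)\<^sup>2 * k
    \<le> p * (p - 1) / 2 * ((1 + a) * (x + w)\<^sup>2 - a * (w ^ 3 + 2 * x ^ 3 + 3 * x\<^sup>2 * w) / (3 * z)) * k"
    using k p by (intro mult_right_mono mult_left_mono) auto
  also have "\<dots> = w\<^sup>2 * ((1 - a) * (1 - a / 2) * k * ((1 + a) - a * w / (3 * z)))
    + (1 - a) * x\<^sup>2 * ((1 - a / 2) * k * ((1 + a) - a * x / (3 / 2 * z)))
    + (2 - a) * x * w * ((1 - a) * k * ((1 + a) - a * x / (2 * z)))"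
    unfolding c using z by (simp add: field_simps power2_eq_square power3_eq_cube)
  also have "\<dots> \<le> w\<^sup>2 * w powr (- a) + (1 - a) * x\<^sup>2 * x powr (- a) + (2 - a) * x * w * x powr (- a)"
    using x w a by (intro add_mono 3 mult_left_mono 1 2) auto
  also have "\<dots> = w powr p + (p - 1) * x powr p + p * x powr (p - 1) * w"
    using x w powr_minus_split[of x p] powr_minus_split[of w p]
    by (simp add: pa p1) (simp add: p_eq algebra_simps)
  finally show ?thesis by (simp add: k_def z_def pa)
qed


text \<open>The gap at y between \<open>\<bar>u\<bar> powr p\<close> and its tangent at x. At p = 1
  and x = 0 the factor \<open>sgn x\<close> selects the subgradient 0.\<close>

definition bregman :: "real \<Rightarrow> real \<Rightarrow> real \<Rightarrow> real" where
  "bregman p x y = \<bar>y\<bar> powr p - \<bar>x\<bar> powr p - p * (sgn x * \<bar>x\<bar> powr (p - 1)) * (y - x)"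

lemma bregman_uminus: "bregman p (- x) (- y) = bregman p x y"
  by (simp add: bregman_def sgn_minus algebra_simps)

lemma bregman_ge_aux:
  assumes p: "1 \<le> p" "p \<le> 2" and x: "0 \<le> x"
  shows "p * (p - 1) / 2 * (y - x)\<^sup>2 * ((2 * \<bar>x\<bar> + \<bar>y\<bar>) / 3) powr (p - 2) \<le> bregman p x y"
proof -
  consider "x = 0" "y = 0" | "x = 0" "y \<noteq> 0" | "0 < x" "0 < y" | "0 < x" "y \<le> 0" using x by linarith
  then show ?thesis
  proof cases
    case 1
    then show ?thesis by (simp add: bregman_def)
  next
    case 2
    \<comment> \<open>From x = 0 the divergence is \<open>\<bar>y\<bar> powr p\<close> and the mean
      is \<bar>y\<bar> / 3, so all that matters is p (p - 1) / 2 \<le>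
      \<open>3 powr (p - 2)\<close>.\<close>
    have "(1 - (2 - p)) * (1 - (2 - p) / 2) \<le> 3 powr (- (2 - p))"
      using p by (intro three_powr_neg_ge) auto
    then have "p * (p - 1) / 2 \<le> 3 powr (p - 2)" by (simp add: field_simps)
    then have "p * (p - 1) / 2 * ((\<bar>y\<bar> / 3) powr (p - 2)) \<le> 3 powr (p - 2) * (\<bar>y\<bar> / 3) powr (p - 2)"
      by (intro mult_right_mono) auto
    also have "\<dots> = \<bar>y\<bar> powr (p - 2)"
      by (simp add: powr_divide)
    finally have "p * (p - 1) / 2 * ((\<bar>y\<bar> / 3) powr (p - 2)) \<le> \<bar>y\<bar> powr (p - 2)" .
    then have "y\<^sup>2 * (p * (p - 1) / 2 * ((\<bar>y\<bar> / 3) powr (p - 2))) \<le> y\<^sup>2 * \<bar>y\<bar> powr (p - 2)"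
      by (intro mult_left_mono) auto
    then show ?thesis
      using 2 powr_minus_split(1)[of "\<bar>y\<bar>" p] by (simp add: bregman_def mult_ac)
  next
    case 3
    then show ?thesis using bregman_powr_pos[OF p 3] by (simp add: bregman_def)
  next
    case 4
    have "x powr p = x * x powr (p - 1)"
      using 4 powr_minus_split[of x p] by (simp add: power2_eq_square)
    then show ?thesis using bregman_powr_neg[OF p, of x "- y"] 4
      by (simp add: bregman_def power2_commute algebra_simps)
  qed
qed

text \<open>Taylor's formula represents the Bregman divergence as an average of \<open>\<bar>u\<bar> powr (p - 2)\<close> over
  the segment from \<open>x\<close> to \<open>y\<close>, with barycentre \<open>(2 x + y) / 3\<close>; this is where the weights 2/3 and 1/3
  come from. They are also admissible in \<open>power_gap\<close>, which the symmetric weights 1/2 are not.\<close>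

lemma bregman_ge:
  fixes p x y s :: real
  assumes p: "1 \<le> p" "p \<le> 2" and s: "s = 2 / p - 1"
  shows "p * (p - 1) / 2 * (y - x)\<^sup>2 * ((2 * \<bar>x\<bar> powr p + \<bar>y\<bar> powr p) / 3) powr (- s) \<le> bregman p x y"
proof -
  define z where "z = (2 * \<bar>x\<bar> + \<bar>y\<bar>) / 3"
  define m where "m = (2 * \<bar>x\<bar> powr p + \<bar>y\<bar> powr p) / 3"
  have s0: "0 \<le> s" using p by (simp add: s field_simps)
  have ps: "p * (- s) = p - 2" using p by (simp add: s field_simps)
  \<comment> \<open>The mean of the p-th powers dominates the p-th power of the mean, and a
    nonpositive exponent reverses the comparison. Sums of p-th powers over a spectrum are Schatten
    powers, which is the point of the exchange.\<close>
  have le: "m powr (- s) \<le> z powr (p - 2)"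
  proof (cases "z = 0")
    case True
    then have "x = 0" "y = 0" unfolding z_def by auto
    then show ?thesis using True by (simp add: m_def)
  next
    case False
    then have z: "0 < z" unfolding z_def by (auto intro!: add_nonneg_nonneg simp: less_le)
    have conv: "((2 * u + v) / 3) powr p \<le> (2 * u powr p + v powr p) / 3"
      if "0 \<le> u" "0 \<le> v" for u v :: real
    proof -
      consider "u = 0" | "v = 0" | "0 < u" "0 < v" using \<open>0 \<le> u\<close> \<open>0 \<le> v\<close> by linarith
      then show ?thesis
      proof cases
        case 1
        have "(1 / 3) powr p \<le> (1 / 3) powr (1 :: real)" using p by (intro powr_mono') auto
        then have "(1 / 3) powr p * v powr p \<le> 1 / 3 * v powr p" by (intro mult_right_mono) auto
        then show ?thesis using 1 p that by (simp add: powr_divide)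
      next
        case 2
        have "(2 / 3) powr p \<le> (2 / 3) powr (1 :: real)" using p by (intro powr_mono') auto
        then have "(2 / 3) powr p * u powr p \<le> 2 / 3 * u powr p" by (intro mult_right_mono) auto
        then show ?thesis using 2 p that by (simp add: powr_divide powr_mult)
      next
        case 3
        have "((1 - 1/3) *\<^sub>R u + (1/3) *\<^sub>R v) powr p \<le> (1 - 1/3) * u powr p + (1/3) * v powr p"
          using p 3 by (intro convex_onD[OF powr_convex]) auto
        then show ?thesis by (simp add: field_simps)
      qed
    qed
    have "z powr p \<le> m" using conv unfolding z_def m_def by simp
    then have "m powr (- s) \<le> (z powr p) powr (- s)"
      using z s0 by (intro powr_mono2') auto
    then show ?thesis using ps by (simp add: powr_powr)
  qed
  have "p * (p - 1) / 2 * (y - x)\<^sup>2 * m powr (- s) \<le> p * (p - 1) / 2 * (y - x)\<^sup>2 * z powr (p - 2)"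
    using le p by (intro mult_left_mono) auto
  also have "\<dots> \<le> bregman p x y"
  proof (cases "0 \<le> x")
    case True
    then show ?thesis unfolding z_def by (intro bregman_ge_aux[OF p])
  next
    case False
    then show ?thesis unfolding z_def
      using bregman_ge_aux[OF p, of "- x" "- y"] by (simp add: bregman_uminus power2_commute)
  qed
  finally show ?thesis by (simp add: m_def)
qed

text \<open>With a fixed, the derivative of the difference of the two sides is nonnegative if 1 + s
  (r - 1) / 2 \<le> \<open>r powr s\<close> for the ratio r = u / z. Since z = (2 a + u) / 3, this
  ratio lies in [1, 3], where ln r \<ge> (r - 1) / 2.\<close>

lemma power_gap:
  fixes a f s :: real
  assumes "0 \<le> a" "a \<le> f" "0 \<le> s"
  shows "(1 + s) * ((f - a) * ((2 * a + f) / 3) powr s) \<le> f powr (1 + s) - a powr (1 + s)"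
proof -
  have r: "1 + s * (r - 1) / 2 \<le> r powr s" if "1 \<le> r" "r \<le> 3" for r :: real
  proof -
    \<comment> \<open>The logarithmic bound comes from exp t \<le> 1 + t + t^2 \<le> 1 + 2 t = r for
      t in [0, 1].\<close>
    define t where "t = (r - 1) / 2"
    have t: "0 \<le> t" "t \<le> 1" "r = 1 + 2 * t" using that by (simp_all add: t_def field_simps)
    have "t\<^sup>2 \<le> t" using t by (simp add: power2_eq_square mult_left_le)
    then have "exp t \<le> r" using exp_bound[of t] t by simp
    then have "t \<le> ln r" using that by (simp add: ln_ge_iff)
    then have "1 + s * t \<le> 1 + s * ln r" using assms by (simp add: mult_left_mono)
    also have "\<dots> \<le> exp (s * ln r)" by (rule exp_ge_add_one_self)
    finally show ?thesis using that by (simp add: powr_def t_def)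
  qed
  consider "f = 0" | "a = 0" "0 < f" | "0 < a" using assms by linarith
  then show ?thesis
  proof cases
    case 1
    then show ?thesis using assms by simp
  next
    case 2
    have "1 + s \<le> 3 powr s" using r[of 3] by simp
    then have "(1 + s) * (f / 3) powr s \<le> f powr s"
      using 2 by (simp add: powr_divide divide_le_eq mult.commute mult_left_mono)
    then have "f * ((1 + s) * (f / 3) powr s) \<le> f * f powr s"
      using 2 by (intro mult_left_mono) auto
    then show ?thesis using 2 by (simp add: powr_add mult_ac)
  next
    case 3
    define G where "G u = u powr (1 + s) - a powr (1 + s) - (1 + s) * ((u - a) * ((2 * a + u) / 3) powr s)" for u
    have "G a \<le> G f"
    proof (rule DERIV_nonneg_imp_nondecreasing[OF assms(2)])
      fix u assume u: "a \<le> u" "u \<le> f"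
      define z where "z = (2 * a + u) / 3"
      have z: "0 < z" using 3 u by (simp add: z_def)
      have "(G has_real_derivative (1 + s) * (u powr s - z powr s - (u - a) * (s / 3) * z powr (s - 1))) (at u)"
        unfolding G_def z_def using 3 u
        by (auto intro!: derivative_eq_intros simp: field_simps)
      moreover have "0 \<le> u powr s - z powr s - (u - a) * (s / 3) * z powr (s - 1)"
      proof -
        have "1 + s * (u / z - 1) / 2 \<le> (u / z) powr s"
          using 3 u z by (intro r) (auto simp: z_def field_simps)
        then have "z powr s * (1 + s * (u / z - 1) / 2) \<le> z powr s * (u / z) powr s"
          by (intro mult_left_mono) auto
        also have "z powr s * (u / z) powr s = u powr s"
          using 3 u z by (simp add: powr_divide)
        also have "u / z - 1 = 2 * (u - a) / (3 * z)" using z by (simp add: z_def field_simps)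
        finally show ?thesis using z by (simp add: powr_diff field_simps)
      qed
      then have "0 \<le> (1 + s) * (u powr s - z powr s - (u - a) * (s / 3) * z powr (s - 1))"
        using assms by (intro mult_nonneg_nonneg) auto
      ultimately show "\<exists>y. DERIV G u :> y \<and> 0 \<le> y" by blast
    qed
    then show ?thesis by (simp add: G_def)
  qed
qed

text \<open>Hoelder's inequality with the exponents on the summands, the form in which it is applied
  with \<theta> = p / 2. It follows from Young's inequality for the terms normalised by the two
  sums.\<close>

lemma sum_powr_Holder:
  fixes u v :: "'a \<Rightarrow> real"
  assumes "finite I" "\<And>i. i \<in> I \<Longrightarrow> 0 \<le> u i" "\<And>i. i \<in> I \<Longrightarrow> 0 \<le> v i" "0 < \<theta>" "\<theta> < 1"
  shows "(\<Sum>i\<in>I. u i powr \<theta> * v i powr (1 - \<theta>)) \<le> (\<Sum>i\<in>I. u i) powr \<theta> * (\<Sum>i\<in>I. v i) powr (1 - \<theta>)"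
proof -
  define U where "U = (\<Sum>i\<in>I. u i)"
  define V where "V = (\<Sum>i\<in>I. v i)"
  have UV: "0 \<le> U" "0 \<le> V" unfolding U_def V_def using assms by (auto intro: sum_nonneg)
  show ?thesis
  proof (cases "U = 0 \<or> V = 0")
    case True
    then have "(\<forall>i\<in>I. u i = 0) \<or> (\<forall>i\<in>I. v i = 0)"
      unfolding U_def V_def using assms by (auto simp: sum_nonneg_eq_0_iff)
    then have "(\<Sum>i\<in>I. u i powr \<theta> * v i powr (1 - \<theta>)) = 0"
      by (intro sum.neutral) auto
    then show ?thesis by simp
  next
    case False
    with UV have pos: "0 < U" "0 < V" by auto
    have young: "x powr \<theta> * y powr (1 - \<theta>) \<le> \<theta> * x + (1 - \<theta>) * y" if "0 \<le> x" "0 \<le> y" for x y :: real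
    proof (cases "x = 0 \<or> y = 0")
      case True
      then show ?thesis using that assms by auto
    next
      case False
      with that have xy: "0 < x" "0 < y" by auto
      have "exp ((1 - (1 - \<theta>)) *\<^sub>R ln x + (1 - \<theta>) *\<^sub>R ln y) \<le> (1 - (1 - \<theta>)) * exp (ln x) + (1 - \<theta>) * exp (ln y)"
        using assms by (intro convex_onD[OF exp_convex]) auto
      then show ?thesis using xy by (simp add: powr_def exp_add)
    qed
    have "(\<Sum>i\<in>I. u i powr \<theta> * v i powr (1 - \<theta>))
        = (\<Sum>i\<in>I. U powr \<theta> * V powr (1 - \<theta>) * ((u i / U) powr \<theta> * (v i / V) powr (1 - \<theta>)))"
      using pos assms by (intro sum.cong refl) (simp add: powr_divide)
    also have "\<dots> \<le> (\<Sum>i\<in>I. U powr \<theta> * V powr (1 - \<theta>) * (\<theta> * (u i / U) + (1 - \<theta>) * (v i / V)))"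
      using pos assms by (intro sum_mono mult_left_mono young) auto
    also have "\<dots> = U powr \<theta> * V powr (1 - \<theta>) * (\<theta> * (U / U) + (1 - \<theta>) * (V / V))"
      by (simp add: U_def V_def sum_distrib_left[symmetric] sum.distrib sum_divide_distrib[symmetric])
    finally show ?thesis using pos by (simp add: U_def V_def)
  qed
qed

section \<open>Quadratic forms with power weights\<close>

text \<open>The first index numbers the vectors, the second their coordinates. Entry functions allow
  rows and columns of a unitary matrix to be treated alike.\<close>

definition orthonormal_rows :: "nat \<Rightarrow> (nat \<Rightarrow> nat \<Rightarrow> complex) \<Rightarrow> bool" where
  "orthonormal_rows N b \<longleftrightarrow>
    (\<forall>k<N. \<forall>l<N. (\<Sum>j<N. b k j * cnj (b l j)) = (if k = l then 1 else 0))"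

lemma orthonormal_rows_parseval:
  assumes "orthonormal_rows N b"
  shows "(\<Sum>j<N. (\<Sum>k<N. c k * b k j) * cnj (\<Sum>l<N. c' l * b l j)) = (\<Sum>k<N. c k * cnj (c' k))"
proof -
  have "(\<Sum>j<N. (\<Sum>k<N. c k * b k j) * cnj (\<Sum>l<N. c' l * b l j))
      = (\<Sum>j<N. \<Sum>k<N. \<Sum>l<N. c k * cnj (c' l) * (b k j * cnj (b l j)))"
    by (simp add: sum_product mult_ac)
  also have "\<dots> = (\<Sum>k<N. \<Sum>l<N. \<Sum>j<N. c k * cnj (c' l) * (b k j * cnj (b l j)))"
    by (rule trans[OF sum.swap]) (intro sum.cong refl sum.swap)
  also have "\<dots> = (\<Sum>k<N. \<Sum>l<N. c k * cnj (c' l) * (if k = l then 1 else 0))"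
    using assms by (intro sum.cong refl) (simp add: orthonormal_rows_def flip: sum_distrib_left)
  also have "\<dots> = (\<Sum>k<N. c k * cnj (c' k))"
  proof (intro sum.cong refl)
    fix k assume "k \<in> {..<N}"
    then show "(\<Sum>l<N. c k * cnj (c' l) * (if k = l then 1 else 0)) = c k * cnj (c' k)"
      by (subst sum.mono_neutral_right[where S = "{k}"]) auto
  qed
  finally show ?thesis .
qed

lemma orthonormal_rows_norm:
  assumes "orthonormal_rows N b"
  shows "(\<Sum>j<N. (cmod (\<Sum>k<N. c k * b k j))\<^sup>2) = (\<Sum>k<N. (cmod (c k))\<^sup>2)"
proof -
  have "complex_of_real (\<Sum>j<N. (cmod (\<Sum>k<N. c k * b k j))\<^sup>2) = complex_of_real (\<Sum>k<N. (cmod (c k))\<^sup>2)"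
    using orthonormal_rows_parseval[OF assms, of c c] by (simp add: complex_norm_square del: of_real_power)
  then show ?thesis by (simp only: of_real_eq_iff)
qed

lemma orthonormal_rows_row_norm:
  assumes "orthonormal_rows N b" "k < N"
  shows "(\<Sum>j<N. (cmod (b k j))\<^sup>2) = 1"
proof -
  have "complex_of_real (\<Sum>j<N. (cmod (b k j))\<^sup>2) = complex_of_real 1"
    using assms by (simp add: orthonormal_rows_def complex_norm_square del: of_real_power)
  then show ?thesis by (simp only: of_real_eq_iff)
qed

text \<open>Substituting x t for t pulls out \<open>x powr (- s)\<close> and leaves C as the
  integral at x = 1, that is pi / sin (pi s). It converges at 0 because s < 1 and at infinity
  because 0 < s.\<close>

lemma powr_resolvent_integral:
  fixes s :: real
  assumes s: "0 < s" "s < 1"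
  obtains C :: real where "0 < C"
    "\<And>x. 0 < x \<Longrightarrow> (\<integral>\<^sup>+t. ennreal (t powr (- s) / (x + t)) * indicator {0<..} t \<partial>lborel) = ennreal (C * x powr (- s))"
proof -
  define I where "I x = (\<integral>\<^sup>+t. ennreal (t powr (- s) / (x + t)) * indicator {0<..} t \<partial>lborel)" for x :: real
  have scale: "I x = ennreal (x powr (- s)) * I 1" if x: "0 < x" for x
  proof -
    have "I x = ennreal \<bar>x\<bar> * (\<integral>\<^sup>+t. ennreal ((0 + x * t) powr (- s) / (x + (0 + x * t))) * indicator {0<..} (0 + x * t) \<partial>lborel)"
      unfolding I_def using x by (intro nn_integral_real_affine) auto
    also have "\<dots> = (\<integral>\<^sup>+t. ennreal \<bar>x\<bar> * (ennreal ((0 + x * t) powr (- s) / (x + (0 + x * t))) * indicator {0<..} (0 + x * t)) \<partial>lborel)"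
      by (rule nn_integral_cmult[symmetric]) auto
    also have "\<dots> = (\<integral>\<^sup>+t. ennreal (x powr (- s)) * (ennreal (t powr (- s) / (1 + t)) * indicator {0<..} t) \<partial>lborel)"
    proof (intro nn_integral_cong)
      fix t :: real
      show "ennreal \<bar>x\<bar> * (ennreal ((0 + x * t) powr (- s) / (x + (0 + x * t))) * indicator {0<..} (0 + x * t))
        = ennreal (x powr (- s)) * (ennreal (t powr (- s) / (1 + t)) * indicator {0<..} t)"
      proof (cases "0 < t")
        case True
        have "\<bar>x\<bar> * ((0 + x * t) powr (- s) / (x + (0 + x * t))) = x powr (- s) * (t powr (- s) / (1 + t))"
        proof -
          have "x + x * t = x * (1 + t)" by (simp add: algebra_simps)
          then show ?thesis using x True by (simp add: powr_mult)
        qed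
        then show ?thesis using x True by (simp flip: ennreal_mult)
      next
        case False
        then show ?thesis using x by (auto simp: zero_less_mult_iff)
      qed
    qed
    also have "\<dots> = ennreal (x powr (- s)) * I 1"
      unfolding I_def by (rule nn_integral_cmult) auto
    finally show ?thesis .
  qed
  have "I 1 \<le> (\<integral>\<^sup>+t. ennreal (t powr (- s)) * indicator {0..1} t + ennreal (t powr (- s - 1)) * indicator {1..} t \<partial>lborel)"
    unfolding I_def
  proof (intro nn_integral_mono)
    fix t :: real
    show "ennreal (t powr (- s) / (1 + t)) * indicator {0<..} t
      \<le> ennreal (t powr (- s)) * indicator {0..1} t + ennreal (t powr (- s - 1)) * indicator {1..} t"
    proof (cases "0 < t \<and> t < 1")
      case True
      then have "t powr (- s) / (1 + t) \<le> t powr (- s)"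
        by (simp add: divide_le_eq mult_le_cancel_left1)
      then show ?thesis using True by (simp add: ennreal_leI)
    next
      case False
      show ?thesis
      proof (cases "1 \<le> t")
        case True
        have "t powr (- s) / (1 + t) \<le> t powr (- s) / t"
          using True by (intro divide_left_mono) auto
        also have "\<dots> = t powr (- s - 1)" using True by (simp add: powr_diff)
        finally have "ennreal (t powr (- s) / (1 + t)) \<le> ennreal (t powr (- s - 1))" by (rule ennreal_leI)
        then show ?thesis using True by (auto simp: add_increasing)
      qed (use False in auto)
    qed
  qed
  also have "\<dots> = (\<integral>\<^sup>+t. ennreal (t powr (- s)) * indicator {0..1} t \<partial>lborel) + (\<integral>\<^sup>+t. ennreal (t powr (- s - 1)) * indicator {1..} t \<partial>lborel)"
    by (rule nn_integral_add) auto
  finally have le: "I 1 \<le> (\<integral>\<^sup>+t. ennreal (t powr (- s)) * indicator {0..1} t \<partial>lborel) + (\<integral>\<^sup>+t. ennreal (t powr (- s - 1)) * indicator {1..} t \<partial>lborel)" .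
  have fin1: "(\<integral>\<^sup>+t. ennreal (t powr (- s)) * indicator {0..1} t \<partial>lborel) < \<infinity>"
  proof -
    have "((\<lambda>t. t powr (- s)) has_integral 1 powr (- s + 1) / (- s + 1)) {0..1}"
      using s by (intro has_integral_powr_from_0) auto
    then have "(\<integral>\<^sup>+t. ennreal (t powr (- s)) * indicator {0..1} t \<partial>lborel) = ennreal (1 powr (- s + 1) / (- s + 1))"
      by (intro nn_integral_has_integral_lebesgue') auto
    then show ?thesis by simp
  qed
  have fin2: "(\<integral>\<^sup>+t. ennreal (t powr (- s - 1)) * indicator {1..} t \<partial>lborel) < \<infinity>"
  proof -
    have "((\<lambda>t. t powr (- s - 1)) has_integral - (1 powr (- s - 1 + 1)) / (- s - 1 + 1)) {1..}"
      using s by (intro has_integral_powr_to_inf) auto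
    then have "(\<integral>\<^sup>+t. ennreal (t powr (- s - 1)) * indicator {1..} t \<partial>lborel) = ennreal (- (1 powr (- s - 1 + 1)) / (- s - 1 + 1))"
      by (intro nn_integral_has_integral_lebesgue') auto
    then show ?thesis by simp
  qed
  have fin: "I 1 < \<infinity>"
    by (rule le_less_trans[OF le]) (use fin1 fin2 in \<open>simp add: ennreal_add_less_top\<close>)
  have "0 < I 1"
  proof -
    have "ennreal (2 powr (- s) / 3) * indicator {1..2} t \<le> ennreal (t powr (- s) / (1 + t)) * indicator {0<..} t" for t :: real
    proof (cases "t \<in> {1..2}")
      case True
      then have "2 powr (- s) / 3 \<le> t powr (- s) / (1 + t)"
        using s by (intro frac_le powr_mono2') auto
      then show ?thesis using True by (simp add: ennreal_leI)
    qed simp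
    then have "(\<integral>\<^sup>+t. ennreal (2 powr (- s) / 3) * indicator {1..2::real} t \<partial>lborel) \<le> I 1"
      unfolding I_def by (intro nn_integral_mono)
    then have "ennreal (2 powr (- s) / 3) \<le> I 1"
      by (simp add: nn_integral_cmult_indicator)
    moreover have "0 < ennreal (2 powr (- s) / 3)" by simp
    ultimately show ?thesis by (rule less_le_trans[rotated])
  qed
  then obtain C where C: "I 1 = ennreal C" "0 < C"
  proof (cases "I 1" rule: ennreal_cases)
    case (real r)
    then show ?thesis using \<open>0 < I 1\<close> by (intro that[of r]) auto
  next
    case top
    then show ?thesis using fin by simp
  qed
  show ?thesis
  proof (rule that[OF C(2)])
    fix x :: real assume "0 < x"
    from scale[OF this] show "(\<integral>\<^sup>+t. ennreal (t powr (- s) / (x + t)) * indicator {0<..} t \<partial>lborel) = ennreal (C * x powr (- s))"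
      using C by (simp add: I_def mult.commute flip: ennreal_mult)
  qed
qed

text \<open>\<open>a k\<close> and \<open>b k\<close> are singular vectors of \<open>B\<close>, and
  \<open>\<beta> k\<close> its singular values up to sign. As both vectors have norm 1,
  \<open>m k\<close> is the mean of the weight \<open>d i + e j\<close> under the squared moduli of
  the entries \<open>a k i * b k j\<close>.\<close>

context
  fixes N :: nat and a b :: "nat \<Rightarrow> nat \<Rightarrow> complex" and d e \<beta> :: "nat \<Rightarrow> real"
    and B :: "nat \<Rightarrow> nat \<Rightarrow> complex" and m :: "nat \<Rightarrow> real"
  assumes a: "orthonormal_rows N a" and b: "orthonormal_rows N b"
    and d: "\<And>i. i < N \<Longrightarrow> 0 \<le> d i" and e: "\<And>j. j < N \<Longrightarrow> 0 \<le> e j"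
  defines "B i j \<equiv> (\<Sum>k<N. \<beta> k * a k i * b k j)"
    and "m k \<equiv> (\<Sum>i<N. d i * (cmod (a k i))\<^sup>2) + (\<Sum>j<N. e j * (cmod (b k j))\<^sup>2)"
begin

lemma diag_weight_nonneg: "0 \<le> m k"
  unfolding m_def using d e by (intro add_nonneg_nonneg sum_nonneg mult_nonneg_nonneg) auto

lemma pairing_singular_vectors:
  fixes p q :: "nat \<Rightarrow> real"
  shows "(\<Sum>i<N. \<Sum>j<N. (\<Sum>k<N. p k * a k i * b k j) * cnj (\<Sum>k<N. q k * a k i * b k j)) = (\<Sum>k<N. p k * q k)"
proof -
  have "(\<Sum>i<N. \<Sum>j<N. (\<Sum>k<N. p k * a k i * b k j) * cnj (\<Sum>k<N. q k * a k i * b k j))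
      = (\<Sum>i<N. \<Sum>k<N. p k * a k i * cnj (q k * a k i))"
    by (intro sum.cong refl orthonormal_rows_parseval[OF b])
  also have "\<dots> = (\<Sum>k<N. \<Sum>i<N. p k * q k * (a k i * cnj (a k i)))"
    by (subst sum.swap) (simp add: mult_ac)
  also have "\<dots> = (\<Sum>k<N. p k * q k)"
    using a by (simp add: orthonormal_rows_def flip: sum_distrib_left)
  finally show ?thesis .
qed

text \<open>This is where the additive form of the weight matters. The part \<open>d i + t\<close>
  is constant in j, so summing over j first kills all cross terms by orthonormality of
  \<open>b\<close>; for the part \<open>e j\<close> the sum over i does the same with
  \<open>a\<close>.\<close>

lemma weighted_norm_singular_vectors:
  fixes p :: "nat \<Rightarrow> real"
  shows "(\<Sum>i<N. \<Sum>j<N. (d i + e j + t) * (cmod (\<Sum>k<N. p k * a k i * b k j))\<^sup>2) = (\<Sum>k<N. (m k + t) * (p k)\<^sup>2)"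
proof -
  have 1: "(\<Sum>j<N. (cmod (\<Sum>k<N. p k * a k i * b k j))\<^sup>2) = (\<Sum>k<N. (p k)\<^sup>2 * (cmod (a k i))\<^sup>2)" for i
    using orthonormal_rows_norm[OF b, of "\<lambda>k. p k * a k i"] by (simp add: norm_mult power_mult_distrib)
  have 2: "(\<Sum>i<N. (cmod (\<Sum>k<N. p k * a k i * b k j))\<^sup>2) = (\<Sum>k<N. (p k)\<^sup>2 * (cmod (b k j))\<^sup>2)" for j
    using orthonormal_rows_norm[OF a, of "\<lambda>k. p k * b k j"] by (simp add: norm_mult power_mult_distrib mult_ac)
  have "(\<Sum>i<N. \<Sum>j<N. (d i + t) * (cmod (\<Sum>k<N. p k * a k i * b k j))\<^sup>2)
      = (\<Sum>i<N. \<Sum>k<N. (d i + t) * ((p k)\<^sup>2 * (cmod (a k i))\<^sup>2))"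
    by (simp only: sum_distrib_left[symmetric] 1)
  also have "\<dots> = (\<Sum>k<N. \<Sum>i<N. (p k)\<^sup>2 * (d i * (cmod (a k i))\<^sup>2) + (p k)\<^sup>2 * t * (cmod (a k i))\<^sup>2)"
    by (subst sum.swap) (simp add: algebra_simps)
  also have "\<dots> = (\<Sum>k<N. (p k)\<^sup>2 * (\<Sum>i<N. d i * (cmod (a k i))\<^sup>2) + (p k)\<^sup>2 * t)"
    using orthonormal_rows_row_norm[OF a] by (simp add: sum.distrib flip: sum_distrib_left)
  finally have A: "(\<Sum>i<N. \<Sum>j<N. (d i + t) * (cmod (\<Sum>k<N. p k * a k i * b k j))\<^sup>2) = \<dots>" .
  have "(\<Sum>i<N. \<Sum>j<N. e j * (cmod (\<Sum>k<N. p k * a k i * b k j))\<^sup>2)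
      = (\<Sum>j<N. \<Sum>k<N. e j * ((p k)\<^sup>2 * (cmod (b k j))\<^sup>2))"
    by (subst sum.swap) (simp only: sum_distrib_left[symmetric] 2)
  also have "\<dots> = (\<Sum>k<N. (p k)\<^sup>2 * (\<Sum>j<N. e j * (cmod (b k j))\<^sup>2))"
    by (subst sum.swap) (simp add: sum_distrib_left mult_ac)
  finally have B: "(\<Sum>i<N. \<Sum>j<N. e j * (cmod (\<Sum>k<N. p k * a k i * b k j))\<^sup>2) = \<dots>" .
  have "(\<Sum>i<N. \<Sum>j<N. (d i + e j + t) * (cmod (\<Sum>k<N. p k * a k i * b k j))\<^sup>2)
     = (\<Sum>i<N. \<Sum>j<N. (d i + t) * (cmod (\<Sum>k<N. p k * a k i * b k j))\<^sup>2)
       + (\<Sum>i<N. \<Sum>j<N. e j * (cmod (\<Sum>k<N. p k * a k i * b k j))\<^sup>2)"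
    unfolding sum.distrib[symmetric] by (intro sum.cong refl) (simp add: algebra_simps)
  also have "\<dots> = (\<Sum>k<N. (m k + t) * (p k)\<^sup>2)"
    unfolding A B m_def sum.distrib[symmetric] by (intro sum.cong refl) (simp add: algebra_simps)
  finally show ?thesis .
qed

text \<open>The weighted form is a maximum of affine functions of the weight, as
  \<open>\<bar>B\<bar>\<^sup>2 / w \<ge> 2 Re (B P\<^sup>*) - w \<bar>P\<bar>\<^sup>2\<close>; for \<open>P\<close> with the same singular vectors as \<open>B\<close>
  the right-hand side sees only the diagonal \<open>m\<close> of the weight.\<close>

lemma resolvent_lower_bound:
  assumes t: "0 < t"
  shows "(\<Sum>k<N. (\<beta> k)\<^sup>2 / (m k + t)) \<le> (\<Sum>i<N. \<Sum>j<N. (cmod (B i j))\<^sup>2 / (d i + e j + t))"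
proof -
  \<comment> \<open>The maximiser of the concave quadratic on the diagonal side, where the
    variational bound thus becomes an equality.\<close>
  define p where "p k = \<beta> k / (m k + t)" for k
  define P where "P i j = (\<Sum>k<N. p k * a k i * b k j)" for i j
  have mt: "0 < m k + t" for k using diag_weight_nonneg[of k] t by simp
  have "complex_of_real (\<Sum>i<N. \<Sum>j<N. Re (B i j * cnj (P i j))) = Re (\<Sum>i<N. \<Sum>j<N. B i j * cnj (P i j))"
    by simp
  also have "(\<Sum>i<N. \<Sum>j<N. B i j * cnj (P i j)) = (\<Sum>k<N. \<beta> k * p k)"
    unfolding B_def P_def by (rule pairing_singular_vectors)
  finally have BP: "(\<Sum>i<N. \<Sum>j<N. Re (B i j * cnj (P i j))) = (\<Sum>k<N. \<beta> k * p k)"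
    by (simp only: of_real_eq_iff Re_complex_of_real)
  have sq: "x\<^sup>2 / w = 2 * (x * (x / w)) - w * (x / w)\<^sup>2" if "0 < w" for x w :: real
    using that by (simp add: power2_eq_square)
  have "(\<Sum>k<N. (\<beta> k)\<^sup>2 / (m k + t)) = (\<Sum>k<N. 2 * (\<beta> k * p k) - (m k + t) * (p k)\<^sup>2)"
    unfolding p_def by (intro sum.cong refl sq mt)
  also have "\<dots> = 2 * (\<Sum>k<N. \<beta> k * p k) - (\<Sum>k<N. (m k + t) * (p k)\<^sup>2)"
    by (simp add: sum_subtractf sum_distrib_left)
  also have "\<dots> = (\<Sum>i<N. \<Sum>j<N. 2 * Re (B i j * cnj (P i j)) - (d i + e j + t) * (cmod (P i j))\<^sup>2)"
    unfolding BP[symmetric] weighted_norm_singular_vectors[symmetric] P_def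
    by (simp add: sum_subtractf sum_distrib_left)
  also have "\<dots> \<le> (\<Sum>i<N. \<Sum>j<N. (cmod (B i j))\<^sup>2 / (d i + e j + t))"
  proof (intro sum_mono)
    fix i j assume "i \<in> {..<N}" "j \<in> {..<N}"
    then have w: "0 < d i + e j + t" using d[of i] e[of j] t by simp
    have "0 \<le> (cmod (B i j) - (d i + e j + t) * cmod (P i j))\<^sup>2 / (d i + e j + t)"
      using w by simp
    also have "\<dots> = (cmod (B i j))\<^sup>2 / (d i + e j + t) - 2 * (cmod (B i j) * cmod (P i j)) + (d i + e j + t) * (cmod (P i j))\<^sup>2"
      using w by (simp add: field_simps power2_eq_square)
    finally have "2 * (cmod (B i j) * cmod (P i j)) - (d i + e j + t) * (cmod (P i j))\<^sup>2 \<le> (cmod (B i j))\<^sup>2 / (d i + e j + t)"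
      by simp
    moreover have "Re (B i j * cnj (P i j)) \<le> cmod (B i j) * cmod (P i j)"
      using complex_Re_le_cmod[of "B i j * cnj (P i j)"] by (simp add: norm_mult)
    ultimately show "2 * Re (B i j * cnj (P i j)) - (d i + e j + t) * (cmod (P i j))\<^sup>2 \<le> (cmod (B i j))\<^sup>2 / (d i + e j + t)"
      by linarith
  qed
  finally show ?thesis .
qed

lemma norm_singular_vectors: "(\<Sum>i<N. \<Sum>j<N. (cmod (B i j))\<^sup>2) = (\<Sum>k<N. (\<beta> k)\<^sup>2)"
proof -
  have "complex_of_real (\<Sum>i<N. \<Sum>j<N. (cmod (B i j))\<^sup>2) = (\<Sum>i<N. \<Sum>j<N. B i j * cnj (B i j))"
    by (simp add: complex_norm_square del: of_real_power)
  also have "\<dots> = complex_of_real (\<Sum>k<N. (\<beta> k)\<^sup>2)"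
    unfolding B_def pairing_singular_vectors by (simp add: power2_eq_square)
  finally show ?thesis by (simp only: of_real_eq_iff)
qed

text \<open>The resolvent bound at \<eta> + t is multiplied by \<open>t powr (- s)\<close> and
  integrated over t > 0; the constant C cancels. At s = 0, where the integral diverges, both sides
  equal the sum of the squares of \<open>\<beta>\<close>. The shift \<eta> keeps all weights
  positive.\<close>

lemma powr_lower_bound:
  assumes s: "0 \<le> s" "s < 1" and \<eta>: "0 < \<eta>"
  shows "(\<Sum>k<N. (\<beta> k)\<^sup>2 * (m k + \<eta>) powr (- s)) \<le> (\<Sum>i<N. \<Sum>j<N. (cmod (B i j))\<^sup>2 * (d i + e j + \<eta>) powr (- s))"
proof (cases "s = 0")
  case True
  have "(\<Sum>k<N. (\<beta> k)\<^sup>2 * (m k + \<eta>) powr (- s)) = (\<Sum>k<N. (\<beta> k)\<^sup>2)"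
  proof (intro sum.cong refl)
    fix k
    have "m k + \<eta> \<noteq> 0" using diag_weight_nonneg[of k] \<eta> by linarith
    then show "(\<beta> k)\<^sup>2 * (m k + \<eta>) powr (- s) = (\<beta> k)\<^sup>2" using True by simp
  qed
  also have "\<dots> = (\<Sum>i<N. \<Sum>j<N. (cmod (B i j))\<^sup>2 * (d i + e j + \<eta>) powr (- s))"
    unfolding norm_singular_vectors[symmetric]
  proof (intro sum.cong refl)
    fix i j assume "i \<in> {..<N}" "j \<in> {..<N}"
    then have "d i + e j + \<eta> \<noteq> 0" using d[of i] e[of j] \<eta> by (simp add: add_nonneg_pos less_imp_neq[THEN not_sym])
    then show "(cmod (B i j))\<^sup>2 = (cmod (B i j))\<^sup>2 * (d i + e j + \<eta>) powr (- s)" using True by simp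
  qed
  finally show ?thesis by simp
next
  case False
  with s have s': "0 < s" "s < 1" by auto
  obtain C where C: "0 < C" and int: "\<And>x. 0 < x \<Longrightarrow>
      (\<integral>\<^sup>+t. ennreal (t powr (- s) / (x + t)) * indicator {0<..} t \<partial>lborel) = ennreal (C * x powr (- s))"
    using powr_resolvent_integral[OF s'] by metis
  define g where "g x t = ennreal (t powr (- s) / (x + t)) * indicator {0<..} t" for x t :: real
  have g_meas [measurable]: "g x \<in> borel_measurable lborel" for x unfolding g_def by measurable
  have g_cmult: "(\<integral>\<^sup>+t. ennreal c * g x t \<partial>lborel) = ennreal (C * (c * x powr (- s)))" if "0 < x" "0 \<le> c" for x c
  proof -
    have "(\<integral>\<^sup>+t. ennreal c * g x t \<partial>lborel) = ennreal c * (\<integral>\<^sup>+t. g x t \<partial>lborel)"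
      by (rule nn_integral_cmult) simp
    also have "\<dots> = ennreal (C * (c * x powr (- s)))"
      using int[OF that(1)] that C by (simp add: g_def mult_ac flip: ennreal_mult)
    finally show ?thesis .
  qed
  have mpos: "0 < m k + \<eta>" for k using diag_weight_nonneg[of k] \<eta> by linarith
  have wpos: "0 < d i + e j + \<eta>" if "i < N" "j < N" for i j using d[OF that(1)] e[OF that(2)] \<eta> by linarith
  have g_sum: "(\<Sum>k\<in>K. ennreal (c k) * g (x k) t) = ennreal (t powr (- s) * (\<Sum>k\<in>K. c k / (x k + t))) * indicator {0<..} t"
    if "\<And>k. k \<in> K \<Longrightarrow> 0 < x k" "\<And>k. k \<in> K \<Longrightarrow> 0 \<le> c k" for K :: "'z set" and x c :: "'z \<Rightarrow> real" and t
  proof (cases "0 < t")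
    case True
    have "(\<Sum>k\<in>K. ennreal (c k) * g (x k) t) = (\<Sum>k\<in>K. ennreal (t powr (- s) * (c k / (x k + t))))"
    proof (intro sum.cong refl)
      fix k assume k: "k \<in> K"
      have "ennreal (c k) * g (x k) t = ennreal (c k * (t powr (- s) / (x k + t)))"
        using True that[OF k] by (simp add: g_def flip: ennreal_mult)
      then show "ennreal (c k) * g (x k) t = ennreal (t powr (- s) * (c k / (x k + t)))"
        by (simp add: mult_ac)
    qed
    also have "\<dots> = ennreal (t powr (- s) * (\<Sum>k\<in>K. c k / (x k + t)))"
      using that True by (subst sum_ennreal) (auto simp: sum_distrib_left intro!: divide_nonneg_pos add_pos_pos)
    finally show ?thesis using True by simp
  next
    case False
    then show ?thesis by (simp add: g_def)
  qed
  have int_sum: "(\<integral>\<^sup>+t. (\<Sum>k\<in>K. ennreal (c k) * g (x k) t) \<partial>lborel) = ennreal (C * (\<Sum>k\<in>K. c k * x k powr (- s)))"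
    if "\<And>k. k \<in> K \<Longrightarrow> 0 < x k" "\<And>k. k \<in> K \<Longrightarrow> 0 \<le> c k" for K :: "'z set" and x c :: "'z \<Rightarrow> real"
  proof -
    have "(\<integral>\<^sup>+t. (\<Sum>k\<in>K. ennreal (c k) * g (x k) t) \<partial>lborel) = (\<Sum>k\<in>K. \<integral>\<^sup>+t. ennreal (c k) * g (x k) t \<partial>lborel)"
      by (rule nn_integral_sum) simp
    also have "\<dots> = (\<Sum>k\<in>K. ennreal (C * (c k * x k powr (- s))))"
      using that by (intro sum.cong refl g_cmult) auto
    also have "\<dots> = ennreal (C * (\<Sum>k\<in>K. c k * x k powr (- s)))"
      using that C by (subst sum_ennreal) (auto simp: sum_distrib_left)
    finally show ?thesis .
  qed
  let ?S = "{..<N} \<times> {..<N}"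
  have "ennreal (C * (\<Sum>k<N. (\<beta> k)\<^sup>2 * (m k + \<eta>) powr (- s)))
      = (\<integral>\<^sup>+t. (\<Sum>k<N. ennreal ((\<beta> k)\<^sup>2) * g (m k + \<eta>) t) \<partial>lborel)"
    using mpos by (intro int_sum[symmetric]) auto
  also have "\<dots> \<le> (\<integral>\<^sup>+t. (\<Sum>z\<in>?S. ennreal ((cmod (B (fst z) (snd z)))\<^sup>2) * g (d (fst z) + e (snd z) + \<eta>) t) \<partial>lborel)"
  proof (intro nn_integral_mono)
    fix t :: real
    have "(\<Sum>k<N. (\<beta> k)\<^sup>2 / (m k + \<eta> + t)) \<le> (\<Sum>z\<in>?S. (cmod (B (fst z) (snd z)))\<^sup>2 / (d (fst z) + e (snd z) + \<eta> + t))" if "0 < t"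
      using resolvent_lower_bound[of "\<eta> + t"] \<eta> that
      by (simp add: sum.cartesian_product case_prod_unfold add_ac)
    then have "ennreal (t powr (- s) * (\<Sum>k<N. (\<beta> k)\<^sup>2 / (m k + \<eta> + t))) * indicator {0<..} t
        \<le> ennreal (t powr (- s) * (\<Sum>z\<in>?S. (cmod (B (fst z) (snd z)))\<^sup>2 / (d (fst z) + e (snd z) + \<eta> + t))) * indicator {0<..} t"
      by (auto simp: indicator_def intro!: ennreal_leI mult_left_mono)
    also have "ennreal (t powr (- s) * (\<Sum>k<N. (\<beta> k)\<^sup>2 / (m k + \<eta> + t))) * indicator {0<..} t
        = (\<Sum>k<N. ennreal ((\<beta> k)\<^sup>2) * g (m k + \<eta>) t)"
      using mpos by (intro g_sum[symmetric]) auto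
    also have "ennreal (t powr (- s) * (\<Sum>z\<in>?S. (cmod (B (fst z) (snd z)))\<^sup>2 / (d (fst z) + e (snd z) + \<eta> + t))) * indicator {0<..} t
        = (\<Sum>z\<in>?S. ennreal ((cmod (B (fst z) (snd z)))\<^sup>2) * g (d (fst z) + e (snd z) + \<eta>) t)"
      using wpos by (intro g_sum[symmetric]) auto
    finally show "(\<Sum>k<N. ennreal ((\<beta> k)\<^sup>2) * g (m k + \<eta>) t)
        \<le> (\<Sum>z\<in>?S. ennreal ((cmod (B (fst z) (snd z)))\<^sup>2) * g (d (fst z) + e (snd z) + \<eta>) t)" .
  qed
  also have "\<dots> = ennreal (C * (\<Sum>z\<in>?S. (cmod (B (fst z) (snd z)))\<^sup>2 * (d (fst z) + e (snd z) + \<eta>) powr (- s)))"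
    using wpos by (intro int_sum) auto
  finally have "C * (\<Sum>k<N. (\<beta> k)\<^sup>2 * (m k + \<eta>) powr (- s))
      \<le> C * (\<Sum>z\<in>?S. (cmod (B (fst z) (snd z)))\<^sup>2 * (d (fst z) + e (snd z) + \<eta>) powr (- s))"
    using C by (subst (asm) ennreal_le_iff) (auto intro!: mult_nonneg_nonneg sum_nonneg)
  then show ?thesis using C by (simp add: sum.cartesian_product case_prod_unfold)
qed

text \<open>Hoelder's inequality for the splitting of \<open>\<bar>\<beta> k\<bar> powr p\<close>
  into \<open>((\<beta> k)\<^sup>2 * m k powr (- s)) powr (p / 2)\<close> and
  \<open>m k powr (1 - p / 2)\<close>, possible as s p / 2 = 1 - p / 2. Since the columns of
  \<open>a\<close> and \<open>b\<close> are unit vectors too, the \<open>m k\<close> sum to the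
  total of all \<open>d i\<close> and \<open>e j\<close>.\<close>

lemma powr_norm_lower_bound:
  assumes p: "1 < p" "p \<le> 2" and s: "s = 2 / p - 1"
    and a_col: "\<And>i. i < N \<Longrightarrow> (\<Sum>k<N. (cmod (a k i))\<^sup>2) = 1"
    and b_col: "\<And>j. j < N \<Longrightarrow> (\<Sum>k<N. (cmod (b k j))\<^sup>2) = 1"
    and zero: "\<And>i j. i < N \<Longrightarrow> j < N \<Longrightarrow> d i + e j = 0 \<Longrightarrow> B i j = 0"
  shows "(\<Sum>k<N. \<bar>\<beta> k\<bar> powr p) powr (2 / p)
    \<le> (\<Sum>i<N. \<Sum>j<N. (cmod (B i j))\<^sup>2 * (d i + e j) powr (- s)) * ((\<Sum>i<N. d i) + (\<Sum>j<N. e j)) powr s"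
proof -
  define M where "M = (\<Sum>i<N. d i) + (\<Sum>j<N. e j)"
  define T where "T = (\<Sum>i<N. \<Sum>j<N. (cmod (B i j))\<^sup>2 * (d i + e j) powr (- s))"
  have s01: "0 \<le> s" "s < 1" using p by (simp_all add: s field_simps)
  have M0: "0 \<le> M" unfolding M_def using d e by (intro add_nonneg_nonneg sum_nonneg) auto
  have T0: "0 \<le> T" unfolding T_def by (intro sum_nonneg mult_nonneg_nonneg) auto
  have sum_m: "(\<Sum>k<N. m k) = M"
  proof -
    have "(\<Sum>k<N. m k) = (\<Sum>i<N. \<Sum>k<N. d i * (cmod (a k i))\<^sup>2) + (\<Sum>j<N. \<Sum>k<N. e j * (cmod (b k j))\<^sup>2)"
      unfolding m_def sum.distrib by (intro arg_cong2[where f = "(+)"] sum.swap)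
    also have "\<dots> = M"
      unfolding M_def using a_col b_col by (simp flip: sum_distrib_left)
    finally show ?thesis .
  qed
  show ?thesis
  proof (cases "M = 0")
    case True
    then have "(\<Sum>i<N. d i) = 0" "(\<Sum>j<N. e j) = 0"
      unfolding M_def using sum_nonneg[of "{..<N}" d] sum_nonneg[of "{..<N}" e] d e
      by (simp_all add: add_nonneg_eq_0_iff)
    then have "\<forall>i<N. d i = 0" "\<forall>j<N. e j = 0"
      using d e sum_nonneg_eq_0_iff[of "{..<N}" d] sum_nonneg_eq_0_iff[of "{..<N}" e] by auto
    then have "(\<Sum>k<N. (\<beta> k)\<^sup>2) = 0"
      unfolding norm_singular_vectors[symmetric] using zero by simp
    then have "(\<Sum>k<N. \<bar>\<beta> k\<bar> powr p) = 0"
      by (simp add: sum_nonneg_eq_0_iff)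
    then show ?thesis using T0 by (simp add: T_def)
  next
    case False
    with M0 have M: "0 < M" by simp
    \<comment> \<open>A vanishing \<open>m k\<close> would spoil the splitting, because 0 to any
      power is 0 here. The weights are therefore shifted by \<eta>, which tends to 0 at the
      end.\<close>
    have step: "(\<Sum>k<N. \<bar>\<beta> k\<bar> powr p) powr (2 / p) \<le> T * (M + N * \<eta>) powr s" if \<eta>: "0 < \<eta>" for \<eta> :: real
    proof -
      define u where "u k = (\<beta> k)\<^sup>2 * (m k + \<eta>) powr (- s)" for k
      have mpos: "0 < m k + \<eta>" for k using diag_weight_nonneg[of k] \<eta> by linarith
      have u0: "0 \<le> u k" for k by (simp add: u_def)
      have U: "(\<Sum>k<N. u k) \<le> T"
      proof -
        have "(\<Sum>k<N. u k) \<le> (\<Sum>i<N. \<Sum>j<N. (cmod (B i j))\<^sup>2 * (d i + e j + \<eta>) powr (- s))"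
          unfolding u_def by (rule powr_lower_bound[OF s01 \<eta>])
        also have "\<dots> \<le> T"
          unfolding T_def
        proof (intro sum_mono)
          fix i j assume ij: "i \<in> {..<N}" "j \<in> {..<N}"
          show "(cmod (B i j))\<^sup>2 * (d i + e j + \<eta>) powr (- s) \<le> (cmod (B i j))\<^sup>2 * (d i + e j) powr (- s)"
          \<comment> \<open>Where the weight vanishes, its power is 0 by convention and bounds
            nothing; the assumption \<open>zero\<close> makes the left side vanish as well.\<close>
          proof (cases "d i + e j = 0")
            case True
            then show ?thesis using zero ij by simp
          next
            case False
            moreover have "0 \<le> d i + e j" using d e ij by simp
            ultimately show ?thesis using \<eta> s01 by (intro mult_left_mono powr_mono2') auto
          qed
        qed
        finally show ?thesis .
      qed
      have "(\<Sum>k<N. \<bar>\<beta> k\<bar> powr p) powr (2 / p) \<le> (\<Sum>k<N. u k) * (\<Sum>k<N. m k + \<eta>) powr s"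
      proof (cases "p = 2")
        case True
        then have "s = 0" by (simp add: s)
        have "(\<Sum>k<N. m k + \<eta>) \<noteq> 0" using sum_m M \<eta>
          by (simp add: sum.distrib add_pos_nonneg less_imp_neq[THEN not_sym])
        then show ?thesis using True \<open>s = 0\<close> mpos u0
          by (simp add: u_def sum_nonneg powr_numeral less_imp_neq[THEN not_sym])
      next
        case False
        with p have p2: "p < 2" by simp
        have "(\<Sum>k<N. \<bar>\<beta> k\<bar> powr p) = (\<Sum>k<N. u k powr (p / 2) * (m k + \<eta>) powr (1 - p / 2))"
        proof (intro sum.cong refl)
          fix k
          have sp: "s * (p / 2) = 1 - p / 2" using p by (simp add: s field_simps)
          have "u k powr (p / 2) = ((\<beta> k)\<^sup>2) powr (p / 2) * ((m k + \<eta>) powr (- s)) powr (p / 2)"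
            unfolding u_def by (rule powr_mult)
          also have "((\<beta> k)\<^sup>2) powr (p / 2) = \<bar>\<beta> k\<bar> powr p"
          proof -
            have "(\<beta> k)\<^sup>2 = \<bar>\<beta> k\<bar> powr 2" by (simp add: powr_numeral)
            then show ?thesis by (simp only: powr_powr) simp
          qed
          also have "((m k + \<eta>) powr (- s)) powr (p / 2) = (m k + \<eta>) powr (- (1 - p / 2))"
            by (simp only: powr_powr mult_minus_left sp)
          finally show "\<bar>\<beta> k\<bar> powr p = u k powr (p / 2) * (m k + \<eta>) powr (1 - p / 2)"
            using mpos[of k] by (simp add: powr_minus less_imp_neq[THEN not_sym] mult.assoc flip: powr_add)
        qed
        also have "\<dots> \<le> (\<Sum>k<N. u k) powr (p / 2) * (\<Sum>k<N. m k + \<eta>) powr (1 - p / 2)"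
          using p p2 u0 mpos[THEN less_imp_le] by (intro sum_powr_Holder) auto
        finally have "(\<Sum>k<N. \<bar>\<beta> k\<bar> powr p) powr (2 / p)
            \<le> ((\<Sum>k<N. u k) powr (p / 2) * (\<Sum>k<N. m k + \<eta>) powr (1 - p / 2)) powr (2 / p)"
          using p by (intro powr_mono2 sum_nonneg) auto
        also have "\<dots> = ((\<Sum>k<N. u k) powr (p / 2)) powr (2 / p) * ((\<Sum>k<N. m k + \<eta>) powr (1 - p / 2)) powr (2 / p)"
          by (rule powr_mult)
        also have "((\<Sum>k<N. u k) powr (p / 2)) powr (2 / p) = (\<Sum>k<N. u k)"
          using p u0 by (simp add: powr_powr sum_nonneg)
        also have "((\<Sum>k<N. m k + \<eta>) powr (1 - p / 2)) powr (2 / p) = (\<Sum>k<N. m k + \<eta>) powr s"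
        proof -
          have "(1 - p / 2) * (2 / p) = s" using p by (simp add: s field_simps)
          then show ?thesis by (simp only: powr_powr)
        qed
        finally show ?thesis .
      qed
      also have "\<dots> \<le> T * (M + N * \<eta>) powr s"
        using U by (simp add: sum.distrib sum_m mult_right_mono)
      finally show ?thesis .
    qed
    have "((\<lambda>\<eta> :: real. T * (M + N * \<eta>) powr s) \<longlongrightarrow> T * (M + real N * 0) powr s) (at_right 0)"
    proof (rule tendsto_mult[OF tendsto_const], rule tendsto_powr[OF _ tendsto_const])
      show "((\<lambda>\<eta> :: real. M + N * \<eta>) \<longlongrightarrow> M + real N * 0) (at_right 0)"
        by (rule tendsto_add[OF tendsto_const], rule tendsto_mult[OF tendsto_const], rule tendsto_ident_at)
    qed (use M in simp)
    moreover have "\<forall>\<^sub>F \<eta> in at_right (0 :: real). (\<Sum>k<N. \<bar>\<beta> k\<bar> powr p) powr (2 / p) \<le> T * (M + N * \<eta>) powr s"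
      using step by (auto simp: eventually_at_right_less intro: eventually_mono[OF eventually_at_right_less])
    ultimately have "(\<Sum>k<N. \<bar>\<beta> k\<bar> powr p) powr (2 / p) \<le> T * (M + real N * 0) powr s"
      by (intro tendsto_lowerbound) auto
    then show ?thesis by (simp add: T_def M_def)
  qed
qed

end

section \<open>Unitary diagonalisation\<close>

lemma mat_adjoint_dim [simp]:
  "dim_row (mat_adjoint A) = dim_col A" "dim_col (mat_adjoint A) = dim_row A"
  by (simp_all add: mat_adjoint_def)

lemma mat_adjoint_carrier [simp]: "A \<in> carrier_mat n k \<Longrightarrow> mat_adjoint A \<in> carrier_mat k n"
  by auto

lemma mat_adjoint_index [simp]:
  "i < dim_col A \<Longrightarrow> j < dim_row A \<Longrightarrow> mat_adjoint A $$ (i, j) = conjugate (A $$ (j, i))"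
  by (simp add: mat_adjoint_def mat_of_rows_index)

lemma mat_adjoint_adjoint [simp]: "mat_adjoint (mat_adjoint A) = (A :: complex mat)"
  by (rule eq_matI) auto

lemma index_mult_mat_sum:
  fixes A :: "complex mat"
  assumes "A \<in> carrier_mat n k" "B \<in> carrier_mat k l" "i < n" "j < l"
  shows "(A * B) $$ (i, j) = (\<Sum>q<k. A $$ (i, q) * B $$ (q, j))"
  using assms by (simp add: scalar_prod_def lessThan_atLeast0)

lemma mat_adjoint_mult:
  fixes A :: "complex mat"
  assumes A: "A \<in> carrier_mat n k" and B: "B \<in> carrier_mat k l"
  shows "mat_adjoint (A * B) = mat_adjoint B * mat_adjoint A"
proof (rule eq_matI)
  fix i j assume "i < dim_row (mat_adjoint B * mat_adjoint A)" "j < dim_col (mat_adjoint B * mat_adjoint A)"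
  then have ij: "i < l" "j < n" using A B by auto
  have "mat_adjoint (A * B) $$ (i, j) = cnj ((A * B) $$ (j, i))" using A B ij by simp
  also have "\<dots> = (\<Sum>q<k. cnj (B $$ (q, i)) * cnj (A $$ (j, q)))"
    using ij by (simp add: index_mult_mat_sum[OF A B] mult.commute)
  also have "\<dots> = (mat_adjoint B * mat_adjoint A) $$ (i, j)"
    using A B ij by (subst index_mult_mat_sum[of _ l k _ n]) auto
  finally show "mat_adjoint (A * B) $$ (i, j) = (mat_adjoint B * mat_adjoint A) $$ (i, j)" .
qed (use A B in auto)

lemma mat_adjoint_four_block:
  fixes A :: "complex mat"
  assumes "A \<in> carrier_mat n n" "D \<in> carrier_mat k k" "B \<in> carrier_mat n k" "C \<in> carrier_mat k n"
  shows "mat_adjoint (four_block_mat A B C D)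
    = four_block_mat (mat_adjoint A) (mat_adjoint C) (mat_adjoint B) (mat_adjoint D)"
  using assms by (intro eq_matI) auto

lemma mat_adjoint_zero [simp]: "mat_adjoint (0\<^sub>m n k :: complex mat) = 0\<^sub>m k n"
  by (rule eq_matI) auto

lemma mat_adjoint_one [simp]: "mat_adjoint (1\<^sub>m n :: complex mat) = 1\<^sub>m n"
  by (rule eq_matI) auto

definition unitary_mat :: "nat \<Rightarrow> complex mat \<Rightarrow> bool" where
  "unitary_mat n U \<longleftrightarrow> U \<in> carrier_mat n n \<and> mat_adjoint U * U = 1\<^sub>m n"

lemma unitary_matD:
  assumes "unitary_mat n U"
  shows "U \<in> carrier_mat n n" "mat_adjoint U * U = 1\<^sub>m n" "U * mat_adjoint U = 1\<^sub>m n"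
  using assms mat_mult_left_right_inverse[of "mat_adjoint U" n U] by (auto simp: unitary_mat_def)

lemma unitary_mat_mult:
  assumes "unitary_mat n U" "unitary_mat n V"
  shows "unitary_mat n (U * V)"
proof -
  note U = unitary_matD[OF assms(1)] and V = unitary_matD[OF assms(2)]
  have "mat_adjoint (U * V) * (U * V) = mat_adjoint V * (mat_adjoint U * U) * V"
    using U(1) V(1) by (simp add: mat_adjoint_mult[of _ n n _ n] assoc_mult_mat[of _ n n _ n _ n] mult_carrier_mat[of _ n n _ n])
  also have "\<dots> = 1\<^sub>m n" using U V by simp
  finally show ?thesis using U V by (simp add: unitary_mat_def)
qed

lemma unitary_mat_adjoint: "unitary_mat n U \<Longrightarrow> unitary_mat n (mat_adjoint U)"
  by (simp add: unitary_mat_def[of n "mat_adjoint U"] unitary_matD)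

text \<open>Gram-Schmidt applied to a basis that begins with v leaves v in place. Dividing the
  orthogonal vectors by their lengths gives the columns of \<open>W\<close>, and c is the reciprocal
  of the length of v.\<close>

lemma unitary_mat_with_first_col:
  fixes v :: "complex Matrix.vec"
  assumes v: "v \<in> carrier_vec n" "v \<noteq> 0\<^sub>v n"
  obtains W c where "unitary_mat n W" "c \<noteq> 0" "Matrix.col W 0 = c \<cdot>\<^sub>v v" "0 < n"
proof -
  interpret cof_vec_space n "TYPE(complex)" .
  have n: "0 < n" using v by (cases n) auto
  define b where "b = basis_completion v"
  from basis_completion[OF v, folded b_def]
  have dist: "distinct b" and indep: "\<not> lin_dep (set b)" and b: "set b \<subseteq> carrier_vec n"
    and hdb: "hd b = v" and len_b: "length b = n" by auto
  from hdb len_b n obtain vs where bv: "b = v # vs" by (cases b) auto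
  define ws where "ws = gram_schmidt n b"
  from gram_schmidt_result[OF b dist indep refl, folded ws_def]
  have ws: "set ws \<subseteq> carrier_vec n" "corthogonal ws" "length ws = n" by (auto simp: len_b)
  have "ws \<noteq> []" using ws(3) n by auto
  moreover have "hd ws = v" using gram_schmidt_hd[OF v(1), of vs] by (simp add: ws_def bv)
  ultimately have hdws: "ws ! 0 = v" by (simp add: hd_conv_nth)
  have wc: "ws ! j \<in> carrier_vec n" if "j < n" for j using ws that by auto
  define q where "q j = (\<Sum>i<n. (cmod (ws ! j $ i))\<^sup>2)" for j
  have sp: "(\<Sum>k<n. ws ! i $ k * cnj (ws ! j $ k)) = (if i = j then complex_of_real (q j) else 0)"
    if ij: "i < n" "j < n" for i j
  proof (cases "i = j")
    case True
    then show ?thesis by (simp add: q_def complex_norm_square del: of_real_power)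
  next
    case False
    have "ws ! i \<bullet>c ws ! j = 0" using corthogonalD[OF ws(2)] ij ws(3) False by simp
    then show ?thesis using False wc[OF ij(1)] wc[OF ij(2)]
      by (simp add: scalar_prod_def lessThan_atLeast0)
  qed
  have q0: "0 < q j" if "j < n" for j
  proof -
    have "ws ! j \<bullet>c ws ! j \<noteq> 0" using corthogonalD[OF ws(2)] that ws(3) by auto
    then have "complex_of_real (q j) \<noteq> 0" using wc[OF that] sp[OF that that]
      by (simp add: scalar_prod_def lessThan_atLeast0)
    moreover have "0 \<le> q j" by (simp add: q_def sum_nonneg)
    ultimately show ?thesis by simp
  qed
  define W where "W = Matrix.mat n n (\<lambda>(i, j). ws ! j $ i / of_real (sqrt (q j)))"
  have W: "W \<in> carrier_mat n n" by (simp add: W_def)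
  have "mat_adjoint W * W = 1\<^sub>m n"
  proof (rule eq_matI)
    fix i j assume "i < dim_row (1\<^sub>m n :: complex mat)" "j < dim_col (1\<^sub>m n :: complex mat)"
    then have ij: "i < n" "j < n" by auto
    have "(mat_adjoint W * W) $$ (i, j) = (\<Sum>k<n. cnj (W $$ (k, i)) * W $$ (k, j))"
      using W ij by (subst index_mult_mat_sum[of _ n n _ n]) auto
    also have "\<dots> = (\<Sum>k<n. (ws ! j $ k * cnj (ws ! i $ k)) * (1 / of_real (sqrt (q i) * sqrt (q j))))"
      using ij by (intro sum.cong refl) (simp add: W_def)
    also have "\<dots> = (if i = j then complex_of_real (q i) else 0) * (1 / of_real (sqrt (q i) * sqrt (q j)))"
      unfolding sum_distrib_right[symmetric] using sp[OF ij(2,1)] by auto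
    also have "\<dots> = 1\<^sub>m n $$ (i, j)"
      using ij q0[OF ij(1)] by (auto simp flip: of_real_mult)
    finally show "(mat_adjoint W * W) $$ (i, j) = 1\<^sub>m n $$ (i, j)" .
  qed (use W in auto)
  then have "unitary_mat n W" using W by (simp add: unitary_mat_def)
  moreover have "Matrix.col W 0 = (1 / of_real (sqrt (q 0))) \<cdot>\<^sub>v v"
    using n v hdws by (intro eq_vecI) (auto simp: W_def)
  moreover have "1 / complex_of_real (sqrt (q 0)) \<noteq> 0" using q0[OF n] by simp
  ultimately show ?thesis using that n by blast
qed

text \<open>Deflation: a unitary change of basis with an eigenvector as first column makes the first
  column of A a multiple of the first unit vector. The new matrix is still Hermitian, so its first
  row has the same shape and its corner is real; the remaining block is Hermitian of size one
  less.\<close>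

lemma hermitian_spectral:
  assumes "A \<in> carrier_mat n n" "mat_adjoint A = A"
  obtains U and ev :: "nat \<Rightarrow> real" where "unitary_mat n U"
    "A = U * mat_diag n (\<lambda>i. of_real (ev i)) * mat_adjoint U"
proof -
  have "\<exists>U (ev :: nat \<Rightarrow> real). unitary_mat n U \<and> A = U * mat_diag n (\<lambda>i. of_real (ev i)) * mat_adjoint U"
    using assms
  proof (induction n arbitrary: A)
    case 0
    then show ?case by (intro exI[of _ "1\<^sub>m 0"] exI[of _ "\<lambda>_. 0"]) (auto simp: unitary_mat_def intro!: eq_matI)
  next
    case (Suc n)
    let ?N = "Suc n"
    note A = Suc.prems(1)
    from spectrum_non_empty[OF A] obtain e where "eigenvalue A e" unfolding spectrum_def by auto
    then obtain v where "eigenvector A v e" unfolding eigenvalue_def by auto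
    then have v: "v \<in> carrier_vec ?N" "v \<noteq> 0\<^sub>v ?N" "A *\<^sub>v v = e \<cdot>\<^sub>v v"
      using A unfolding eigenvector_def by auto
    from unitary_mat_with_first_col[OF v(1,2)] obtain W c where W: "unitary_mat ?N W"
      and c: "Matrix.col W 0 = c \<cdot>\<^sub>v v" by metis
    note WD = unitary_matD[OF W]
    have aW: "mat_adjoint W \<in> carrier_mat ?N ?N" using WD by simp
    define A' where "A' = mat_adjoint W * A * W"
    have A': "A' \<in> carrier_mat ?N ?N" using WD A unfolding A'_def by (intro mult_carrier_mat[of _ ?N ?N]) auto
    have A'_herm: "mat_adjoint A' = A'"
      using WD A Suc.prems(2)
      by (simp add: A'_def mat_adjoint_mult[of _ ?N ?N _ ?N] assoc_mult_mat[of _ ?N ?N _ ?N _ ?N] mult_carrier_mat[of _ ?N ?N _ ?N])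
    have A_eq: "A = W * A' * mat_adjoint W"
    proof -
      have "W * A' * mat_adjoint W = (W * mat_adjoint W) * A * (W * mat_adjoint W)"
        using WD(1) A aW by (simp add: A'_def assoc_mult_mat[of _ ?N ?N _ ?N _ ?N] mult_carrier_mat[of _ ?N ?N _ ?N])
      then show ?thesis using WD A by simp
    qed
    have col0: "A' $$ (i, 0) = (if i = 0 then e else 0)" if i: "i < ?N" for i
    proof -
      have "A' = mat_adjoint W * (A * W)"
        using WD(1) A aW by (simp add: A'_def assoc_mult_mat[of _ ?N ?N _ ?N _ ?N])
      then have "Matrix.col A' 0 = mat_adjoint W *\<^sub>v Matrix.col (A * W) 0"
        by (simp only: col_mult2[OF aW mult_carrier_mat[OF A WD(1)] zero_less_Suc])
      also have "Matrix.col (A * W) 0 = A *\<^sub>v Matrix.col W 0"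
        by (rule col_mult2[OF A WD(1) zero_less_Suc])
      also have "A *\<^sub>v Matrix.col W 0 = e \<cdot>\<^sub>v Matrix.col W 0"
        using A v by (simp add: c mult_mat_vec[of _ ?N ?N] smult_smult_assoc mult.commute)
      also have "mat_adjoint W *\<^sub>v (e \<cdot>\<^sub>v Matrix.col W 0) = e \<cdot>\<^sub>v Matrix.col (mat_adjoint W * W) 0"
        using WD(1) aW c v(1) by (simp add: mult_mat_vec[OF aW] col_mult2[OF aW WD(1)])
      finally have "Matrix.col A' 0 $ i = (e \<cdot>\<^sub>v Matrix.col (1\<^sub>m ?N) 0) $ i" using WD by simp
      then show ?thesis using A' i by simp
    qed
    obtain A1 A2 A0 A3 where split: "split_block A' 1 1 = (A1, A2, A0, A3)"
      by (cases "split_block A' 1 1")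
    from A' have "dim_row A' = 1 + n" "dim_col A' = 1 + n" by auto
    note sb = split_block[OF split this]
    have A'_entry: "A' $$ (i, j) = cnj (A' $$ (j, i))" if "i < ?N" "j < ?N" for i j
      using mat_adjoint_index[of i A' j] A' that by (simp add: A'_herm)
    have "cnj e = e" using A'_entry[of 0 0] col0[of 0] by simp
    then have e: "e = of_real (Re e)" by (metis Reals_cnj_iff of_real_Re)
    have row0: "A' $$ (0, j) = (if j = 0 then e else 0)" if j: "j < ?N" for j
    proof -
      have "A' $$ (0, j) = cnj (if j = 0 then e else 0)"
        using A'_entry[of 0 j] j by (simp only: col0[OF j] zero_less_Suc)
      then show ?thesis using \<open>cnj e = e\<close> by simp
    qed
    have A3_idx: "A3 $$ (i, j) = A' $$ (Suc i, Suc j)" if "i < n" "j < n" for i j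
      using that sb by auto
    have "mat_adjoint A3 = A3"
    proof (rule eq_matI)
      fix i j assume "i < dim_row A3" "j < dim_col A3"
      then have ij: "i < n" "j < n" using sb by auto
      then show "mat_adjoint A3 $$ (i, j) = A3 $$ (i, j)"
        using sb(4) A'_entry[of "Suc i" "Suc j"] by (simp add: A3_idx)
    qed (use sb in auto)
    from Suc.IH[OF sb(4) this] obtain V ev where V: "unitary_mat n V"
      and A3: "A3 = V * mat_diag n (\<lambda>i. complex_of_real (ev i)) * mat_adjoint V" by blast
    note VD = unitary_matD[OF V]
    define E where "E = Matrix.mat 1 1 (\<lambda>_. e)"
    define D where "D = mat_diag n (\<lambda>i. complex_of_real (ev i))"
    define X where "X = four_block_mat (1\<^sub>m 1) (0\<^sub>m 1 n) (0\<^sub>m n 1) V"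
    have E: "E \<in> carrier_mat 1 1" by (simp add: E_def)
    have D: "D \<in> carrier_mat n n" by (simp add: D_def)
    have X: "X \<in> carrier_mat ?N ?N" using VD four_block_carrier_mat[of "1\<^sub>m 1" 1 1 V n n] by (simp add: X_def)
    have aX: "mat_adjoint X = four_block_mat (1\<^sub>m 1) (0\<^sub>m 1 n) (0\<^sub>m n 1) (mat_adjoint V)"
      unfolding X_def using VD by (subst mat_adjoint_four_block[of _ 1 _ n]) auto
    have "mat_adjoint X * X = 1\<^sub>m (1 + n)"
      unfolding aX unfolding X_def
      by (subst mult_four_block_mat[of _ 1 1 _ n _ n _ _ 1 _ n]) (use VD in auto)
    then have Xu: "unitary_mat ?N X" using X by (simp add: unitary_mat_def)
    have "A' = four_block_mat E (0\<^sub>m 1 n) (0\<^sub>m n 1) A3"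
    proof (rule eq_matI)
      fix i j assume "i < dim_row (four_block_mat E (0\<^sub>m 1 n) (0\<^sub>m n 1) A3)"
        "j < dim_col (four_block_mat E (0\<^sub>m 1 n) (0\<^sub>m n 1) A3)"
      then have ij: "i < ?N" "j < ?N" using E sb(4) by auto
      show "A' $$ (i, j) = four_block_mat E (0\<^sub>m 1 n) (0\<^sub>m n 1) A3 $$ (i, j)"
        using ij E sb(4) A3_idx[of "i - 1" "j - 1"] col0[OF ij(1)] row0[OF ij(2)]
        by (cases i; cases j) (auto simp: E_def)
    qed (use A' E sb(4) in auto)
    also have "\<dots> = X * four_block_mat E (0\<^sub>m 1 n) (0\<^sub>m n 1) D * mat_adjoint X"
      unfolding A3 D_def[symmetric] aX unfolding X_def
      using VD E D
      by (subst mult_four_block_mat[of _ 1 1 _ n _ n _ _ 1 _ n], auto)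
         (subst mult_four_block_mat[of _ 1 1 _ n _ n _ _ 1 _ n], auto)
    also have "four_block_mat E (0\<^sub>m 1 n) (0\<^sub>m n 1) D
      = mat_diag ?N (\<lambda>i. complex_of_real (case i of 0 \<Rightarrow> Re e | Suc i \<Rightarrow> ev i))"
      (is "_ = ?D")
      using e[symmetric] by (intro eq_matI) (auto simp: E_def D_def mat_diag_def split: nat.split)
    finally have A'_eq: "A' = X * ?D * mat_adjoint X" .
    have D': "?D \<in> carrier_mat ?N ?N" by simp
    have "A = (W * X) * ?D * mat_adjoint (W * X)"
      unfolding A_eq A'_eq using WD(1) X D'
      by (simp add: mat_adjoint_mult[of _ ?N ?N _ ?N] assoc_mult_mat[of _ ?N ?N _ ?N _ ?N] mult_carrier_mat[of _ ?N ?N _ ?N] del: mat_diag_dim)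
    then show ?case using unitary_mat_mult[OF W Xu] by blast
  qed
  then show ?thesis using that by blast
qed

section \<open>Schatten norms\<close>

text \<open>For invertible A the two products are similar. In general the block matrices
  \<open>X\<close> and \<open>Y\<close> are similar through the shear \<open>P\<close>, and the
  common factor, the characteristic polynomial of the zero block, cancels.\<close>

lemma char_poly_mult_commute:
  fixes A B :: "complex mat"
  assumes A: "A \<in> carrier_mat n n" and B: "B \<in> carrier_mat n n"
  shows "char_poly (A * B) = char_poly (B * A)"
proof -
  let ?Z = "0\<^sub>m n n :: complex mat" and ?I = "1\<^sub>m n :: complex mat"
  define X where "X = four_block_mat (A * B) ?Z B ?Z"
  define Y where "Y = four_block_mat ?Z ?Z B (B * A)"
  define P where "P = four_block_mat ?I A ?Z ?I"
  define Q where "Q = four_block_mat ?I (- A) ?Z ?I"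
  have carr: "X \<in> carrier_mat (n + n) (n + n)" "Y \<in> carrier_mat (n + n) (n + n)"
    "P \<in> carrier_mat (n + n) (n + n)" "Q \<in> carrier_mat (n + n) (n + n)"
    using A B by (auto simp: X_def Y_def P_def Q_def)
  have AB: "A * B \<in> carrier_mat n n" "B * A \<in> carrier_mat n n" using A B by auto
  note mult = mult_four_block_mat[of _ n n _ n _ n _ _ n _ n]
  have uz: "- ?Z + ?I = ?I" by (rule eq_matI) auto
  have PQ: "P * Q = 1\<^sub>m (n + n)"
    unfolding P_def Q_def using A by (subst mult) (auto simp: uz add_uminus_minus_mat minus_r_inv_mat)
  have QP: "Q * P = 1\<^sub>m (n + n)"
    using mat_mult_left_right_inverse[OF carr(3,4) PQ] .
  have "X * P = P * Y"
    unfolding P_def X_def Y_def using A B AB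
    by (subst mult; simp; subst mult; simp add: assoc_mult_mat[of _ n n _ n _ n])
  then have "X * (P * Q) = P * Y * Q"
    using carr by (metis assoc_mult_mat)
  then have "X = P * Y * Q" using PQ carr by simp
  then have "similar_mat X Y"
    using similar_mat_witI[OF PQ QP _ carr] unfolding similar_mat_def by blast
  then have "char_poly X = char_poly Y" by (rule char_poly_similar)
  moreover have "char_poly X = char_poly (A * B) * char_poly ?Z"
    using AB A B char_poly_factorized[OF AB(1)] char_poly_factorized[of ?Z n]
    by (intro char_poly_0_block'[OF X_def _ _ AB(1) B]) auto
  moreover have "char_poly Y = char_poly ?Z * char_poly (B * A)"
    using AB A B char_poly_factorized[OF AB(2)] char_poly_factorized[of ?Z n]
    by (intro char_poly_0_block'[OF Y_def _ _ _ B AB(2)]) auto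
  moreover have "char_poly ?Z \<noteq> 0"
    using degree_monic_char_poly[of ?Z n] by auto
  ultimately show ?thesis by simp
qed

text \<open>The Hermitian dilation is real-linear in M and has the singular values of M and their
  negatives as eigenvalues. It gives arbitrary square matrices a spectral calculus, at the price of
  a factor 2 in the traces.\<close>

definition dilation :: "nat \<Rightarrow> complex mat \<Rightarrow> complex mat" where
  "dilation m M = four_block_mat (0\<^sub>m m m) M (mat_adjoint M) (0\<^sub>m m m)"

lemma dilation_carrier [simp]: "dilation m M \<in> carrier_mat (m + m) (m + m)"
  by (simp add: dilation_def)

lemma mat_adjoint_dilation: "M \<in> carrier_mat m m \<Longrightarrow> mat_adjoint (dilation m M) = dilation m M"
  unfolding dilation_def by (subst mat_adjoint_four_block[of _ m _ m]) auto

lemma char_poly_unitary_diag: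
  assumes U: "unitary_mat n U"
  shows "char_poly (U * mat_diag n f * mat_adjoint U) = (\<Prod>i<n. [:- f i, 1:])"
proof -
  note UD = unitary_matD[OF U]
  have "similar_mat (U * mat_diag n f * mat_adjoint U) (mat_diag n f)"
    unfolding similar_mat_def using UD
    by (intro exI[of _ U] exI[of _ "mat_adjoint U"] similar_mat_witI[of _ _ n])
       (auto intro!: mult_carrier_mat[of _ n n] simp del: mat_diag_dim intro: mat_diag_dim)
  then have "char_poly (U * mat_diag n f * mat_adjoint U) = char_poly (mat_diag n f)"
    by (rule char_poly_similar)
  also have "\<dots> = (\<Prod>a\<leftarrow>diag_mat (mat_diag n f). [:- a, 1:])"
    by (intro char_poly_upper_triangular[of _ n]) (auto simp: mat_diag_def)
  also have "diag_mat (mat_diag n f) = map f [0..<n]"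
    unfolding diag_mat_def mat_diag_def by (intro map_cong) auto
  also have "(\<Prod>a\<leftarrow>map f [0..<n]. [:- a, 1:]) = (\<Prod>i<n. [:- f i, 1:])"
    by (simp add: prod.list_conv_set_nth lessThan_atLeast0)
  finally show ?thesis .
qed

text \<open>The trace of the p-th power of \<bar>M\<bar>. Unlike the norm it adds up over points, so
  the estimates are carried out for sums of such powers, raised to 2 / p.\<close>

definition schatten_pow :: "real \<Rightarrow> complex mat \<Rightarrow> real" where
  "schatten_pow p M = (\<Sum>s\<in>#singular_values M. s powr p)"

lemma schatten_pow_nonneg [simp]: "0 \<le> schatten_pow p M"
proof -
  have "0 \<le> (\<Sum>s\<in>#A. s powr p)" for A :: "real multiset" by (induction A) auto
  then show ?thesis by (simp add: schatten_pow_def)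
qed

lemma schatten_norm_powr: "p \<noteq> 0 \<Longrightarrow> schatten_norm p M powr p = schatten_pow p M"
  unfolding schatten_norm_def schatten_pow_def[symmetric] by (simp add: powr_powr)

lemma schatten_norm_square: "(schatten_norm p M)\<^sup>2 = schatten_pow p M powr (2 / p)"
proof -
  have "(schatten_norm p M)\<^sup>2 = (schatten_pow p M powr (1 / p)) powr 2"
    by (simp add: schatten_norm_def schatten_pow_def powr_numeral)
  then show ?thesis by (simp only: powr_powr) simp
qed

text \<open>The square of the dilation is \<open>diag(M M\<^sup>*, M\<^sup>* M)\<close>, so the squares of its eigenvalues are
  the squared singular values, each taken twice.\<close>

lemma dilation_spectral:
  assumes M: "M \<in> carrier_mat m m"
  obtains U and ev :: "nat \<Rightarrow> real" where "unitary_mat (m + m) U"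
    "dilation m M = U * mat_diag (m + m) (\<lambda>i. of_real (ev i)) * mat_adjoint U"
    "\<And>p. (\<Sum>i<m + m. \<bar>ev i\<bar> powr p) = 2 * schatten_pow p M"
proof -
  let ?n = "m + m"
  obtain U and ev :: "nat \<Rightarrow> real" where U: "unitary_mat ?n U"
    and eq: "dilation m M = U * mat_diag ?n (\<lambda>i. of_real (ev i)) * mat_adjoint U"
    using hermitian_spectral[OF dilation_carrier mat_adjoint_dilation[OF M]] by metis
  note UD = unitary_matD[OF U]
  define D where "D = mat_diag ?n (\<lambda>i. complex_of_real (ev i))"
  have D: "D \<in> carrier_mat ?n ?n" by (simp add: D_def)
  have aU: "mat_adjoint U \<in> carrier_mat ?n ?n" using UD by simp
  have MM: "M * mat_adjoint M \<in> carrier_mat m m" "mat_adjoint M * M \<in> carrier_mat m m" using M by auto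
  have "dilation m M * dilation m M = four_block_mat (M * mat_adjoint M) (0\<^sub>m m m) (0\<^sub>m m m) (mat_adjoint M * M)"
    unfolding dilation_def using M by (subst mult_four_block_mat[of _ m m _ m _ m _ _ m _ m]) auto
  then have "char_poly (dilation m M * dilation m M) = char_poly (M * mat_adjoint M) * char_poly (mat_adjoint M * M)"
    using MM char_poly_factorized[OF MM(1)] char_poly_factorized[OF MM(2)]
    by (intro char_poly_0_block[of _ _ "0\<^sub>m m m" m m]) auto
  also have "char_poly (M * mat_adjoint M) = char_poly (mat_adjoint M * M)"
    using M by (intro char_poly_mult_commute[of _ m]) auto
  finally have cp1: "char_poly (dilation m M * dilation m M) = char_poly (mat_adjoint M * M) * char_poly (mat_adjoint M * M)" .
  have "dilation m M * dilation m M = U * D * (mat_adjoint U * U) * D * mat_adjoint U"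
    unfolding eq D_def[symmetric] using UD(1) D aU
    by (simp add: assoc_mult_mat[of _ ?n ?n _ ?n _ ?n] mult_carrier_mat[of _ ?n ?n _ ?n])
  also have "\<dots> = U * (D * D) * mat_adjoint U"
    using UD D aU by (simp add: assoc_mult_mat[of _ ?n ?n _ ?n _ ?n] mult_carrier_mat[of _ ?n ?n _ ?n])
  also have "D * D = mat_diag ?n (\<lambda>i. complex_of_real ((ev i)\<^sup>2))"
    by (simp add: D_def power2_eq_square)
  finally have cp2: "char_poly (dilation m M * dilation m M) = (\<Prod>i<?n. [:- complex_of_real ((ev i)\<^sup>2), 1:])"
    by (simp only: char_poly_unitary_diag[OF U])
  have ne: "char_poly (mat_adjoint M * M) \<noteq> 0"
    using degree_monic_char_poly[OF MM(2)] by auto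
  have roots: "proots (char_poly (mat_adjoint M * M)) + proots (char_poly (mat_adjoint M * M))
    = (\<Sum>i<?n. {# complex_of_real ((ev i)\<^sup>2) #})"
  proof -
    have "proots (char_poly (mat_adjoint M * M)) + proots (char_poly (mat_adjoint M * M))
      = proots (\<Prod>i<?n. [:- complex_of_real ((ev i)\<^sup>2), 1:])"
      using ne by (simp only: proots_mult[symmetric] cp1[symmetric] cp2 not_False_eq_True)
    also have "\<dots> = (\<Sum>i<?n. {# complex_of_real ((ev i)\<^sup>2) #})"
      by (subst proots_prod) (auto simp: proots_linear_factor)
    finally show ?thesis .
  qed
  have "(\<Sum>i<?n. \<bar>ev i\<bar> powr p) = 2 * schatten_pow p M" for p
  proof -
    define g where "g z = sqrt (Re z) powr p" for z
    have "2 * schatten_pow p M = (\<Sum>z\<in>#proots (char_poly (mat_adjoint M * M)) + proots (char_poly (mat_adjoint M * M)). g z)"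
      by (simp add: schatten_pow_def singular_values_def g_def image_mset.compositionality o_def)
    also have "\<dots> = (\<Sum>i<?n. g (complex_of_real ((ev i)\<^sup>2)))"
    proof -
      have "(\<Sum>z\<in>#(\<Sum>i<n. {# complex_of_real ((ev i)\<^sup>2) #}). g z) = (\<Sum>i<n. g (complex_of_real ((ev i)\<^sup>2)))" for n
        by (induction n) auto
      then show ?thesis by (simp only: roots)
    qed
    finally show ?thesis by (simp add: g_def)
  qed
  with U eq that show ?thesis by blast
qed

lemma unitary_orthonormal_rows:
  assumes "unitary_mat n V"
  shows "orthonormal_rows n (\<lambda>k j. V $$ (k, j))" "orthonormal_rows n (\<lambda>k i. V $$ (i, k))"
proof -
  note VD = unitary_matD[OF assms]
  show "orthonormal_rows n (\<lambda>k j. V $$ (k, j))"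
    unfolding orthonormal_rows_def
  proof (intro allI impI)
    fix k l assume kl: "k < n" "l < n"
    have "(\<Sum>j<n. V $$ (k, j) * cnj (V $$ (l, j))) = (V * mat_adjoint V) $$ (k, l)"
      using VD kl by (subst index_mult_mat_sum[of _ n n _ n]) auto
    then show "(\<Sum>j<n. V $$ (k, j) * cnj (V $$ (l, j))) = (if k = l then 1 else 0)"
      using VD kl by simp
  qed
  show "orthonormal_rows n (\<lambda>k i. V $$ (i, k))"
    unfolding orthonormal_rows_def
  proof (intro allI impI)
    fix k l assume kl: "k < n" "l < n"
    have "(\<Sum>j<n. V $$ (j, k) * cnj (V $$ (j, l))) = (mat_adjoint V * V) $$ (l, k)"
      using VD(1) kl by (subst index_mult_mat_sum[of _ n n _ n]) (auto simp: mult.commute)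
    then show "(\<Sum>j<n. V $$ (j, k) * cnj (V $$ (j, l))) = (if k = l then 1 else 0)"
      using VD kl by simp
  qed
qed


text \<open>\<open>\<phi>\<close> is the derivative of \<open>schatten_pow p\<close> at \<open>X\<close>. In eigenbases \<open>u\<^sub>i\<close> of the dilation of \<open>X\<close>
  and \<open>v\<^sub>j\<close> of the dilation of \<open>Y\<close>, the Bregman divergence is half the sum of the scalar Bregman
  divergences of the eigenvalues with weights \<open>\<bar>\<langle>u\<^sub>i, v\<^sub>j\<rangle>\<bar>\<^sup>2\<close> (Klein's argument).\<close>

lemma schatten_bregman:
  fixes X :: "complex mat"
  assumes p: "1 \<le> p" "p \<le> 2" and s: "s = 2 / p - 1" and X: "X \<in> carrier_mat m m"
  obtains \<phi> :: "complex mat \<Rightarrow> real" where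
    "\<And>(I :: nat set) G. (\<And>y. y \<in> I \<Longrightarrow> G y \<in> carrier_mat m m) \<Longrightarrow>
      (\<And>i j. i < m \<Longrightarrow> j < m \<Longrightarrow> (\<Sum>y\<in>I. G y $$ (i, j)) = 0) \<Longrightarrow> (\<Sum>y\<in>I. \<phi> (G y)) = 0"
    "\<And>Y. Y \<in> carrier_mat m m \<Longrightarrow> 0 \<le> schatten_pow p Y - schatten_pow p X - \<phi> (Y - X)"
    "\<And>Y. Y \<in> carrier_mat m m \<Longrightarrow>
      p * (p - 1) / 2 * schatten_pow p (Y - X) powr (2 / p)
      \<le> (schatten_pow p Y - schatten_pow p X - \<phi> (Y - X))
        * ((2 * schatten_pow p X + schatten_pow p Y) / 3) powr s"
proof -
  let ?n = "m + m"
  obtain U and lam :: "nat \<Rightarrow> real" where U: "unitary_mat ?n U"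
    and X_eq: "dilation m X = U * mat_diag ?n (\<lambda>i. of_real (lam i)) * mat_adjoint U"
    and lam: "\<And>p. (\<Sum>i<m + m. \<bar>lam i\<bar> powr p) = 2 * schatten_pow p X"
    using dilation_spectral[OF X] by metis
  note UD = unitary_matD[OF U]
  \<comment> \<open>p times h is the derivative of \<open>\<bar>x\<bar> powr p\<close>, with the
    subgradient 0 at 0 if p = 1. The factor p / 2 in \<open>\<phi>\<close> undoes the doubling of
    the trace.\<close>
  define h where "h x = sgn x * \<bar>x\<bar> powr (p - 1)" for x :: real
  define \<phi> where "\<phi> B = p / 2 * (\<Sum>i<?n. h (lam i) * Re ((mat_adjoint U * dilation m B * U) $$ (i, i)))" for B
  have entry: "(mat_adjoint U * dilation m B * U) $$ (i, j)
      = (\<Sum>k<?n. \<Sum>l<?n. cnj (U $$ (l, i)) * dilation m B $$ (l, k) * U $$ (k, j))"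
    if "i < ?n" "j < ?n" for B i j
  proof -
    have "mat_adjoint U * dilation m B \<in> carrier_mat ?n ?n"
      using UD(1) by (intro mult_carrier_mat[of _ ?n ?n]) auto
    then have "(mat_adjoint U * dilation m B * U) $$ (i, j) = (\<Sum>k<?n. (mat_adjoint U * dilation m B) $$ (i, k) * U $$ (k, j))"
      using that UD(1) by (intro index_mult_mat_sum[of _ ?n ?n _ ?n]) auto
    also have "\<dots> = (\<Sum>k<?n. \<Sum>l<?n. cnj (U $$ (l, i)) * dilation m B $$ (l, k) * U $$ (k, j))"
      using that UD(1)
      by (intro sum.cong refl) (subst index_mult_mat_sum[of _ ?n ?n _ ?n], auto simp: sum_distrib_right)
    finally show ?thesis .
  qed
  \<comment> \<open>Additivity of \<open>\<phi>\<close>, in the form that later removes the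
    first-order terms. The vanishing sum is expressed entrywise because matrices of unspecified size
    have no zero.\<close>
  have \<phi>_sum: "(\<Sum>y\<in>I. \<phi> (G y)) = 0"
    if G: "\<And>y. y \<in> I \<Longrightarrow> G y \<in> carrier_mat m m"
      and G0: "\<And>i j. i < m \<Longrightarrow> j < m \<Longrightarrow> (\<Sum>y\<in>I. G y $$ (i, j)) = 0" for I :: "nat set" and G
  proof -
    have dil0: "(\<Sum>y\<in>I. dilation m (G y) $$ (l, k)) = 0" if "l < ?n" "k < ?n" for l k
    proof -
      have idx: "dilation m (G y) $$ (l, k) =
          (if l < m then if k < m then 0 else G y $$ (l, k - m)
           else if k < m then cnj (G y $$ (k, l - m)) else 0)" if "y \<in> I" for y
        using G[OF that] \<open>l < ?n\<close> \<open>k < ?n\<close> by (auto simp: dilation_def)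
      have "(\<Sum>y\<in>I. dilation m (G y) $$ (l, k)) =
          (\<Sum>y\<in>I. if l < m then if k < m then 0 else G y $$ (l, k - m)
           else if k < m then cnj (G y $$ (k, l - m)) else 0)"
        by (intro sum.cong refl idx)
      also have "\<dots> = 0"
        using G0[of l "k - m"] G0[of k "l - m"] that
        by (cases "l < m"; cases "k < m") (simp_all flip: cnj_sum)
      finally show ?thesis .
    qed
    have zero: "(\<Sum>y\<in>I. (mat_adjoint U * dilation m (G y) * U) $$ (i, i)) = 0" if "i < ?n" for i
    proof -
      have "(\<Sum>y\<in>I. (mat_adjoint U * dilation m (G y) * U) $$ (i, i))
          = (\<Sum>k<?n. \<Sum>l<?n. \<Sum>y\<in>I. cnj (U $$ (l, i)) * dilation m (G y) $$ (l, k) * U $$ (k, i))"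
        unfolding entry[OF that that]
        by (rule trans[OF sum.swap]) (intro sum.cong refl sum.swap)
      also have "\<dots> = 0"
        using dil0 by (simp flip: sum_distrib_left sum_distrib_right)
      finally show ?thesis .
    qed
    have "(\<Sum>y\<in>I. \<phi> (G y))
        = (\<Sum>i<?n. p / 2 * (h (lam i) * (\<Sum>y\<in>I. Re ((mat_adjoint U * dilation m (G y) * U) $$ (i, i)))))"
      unfolding \<phi>_def sum_distrib_left by (rule sum.swap)
    also have "\<dots> = 0"
      using zero by (simp flip: Re_sum)
    finally show ?thesis .
  qed
  have main: "0 \<le> schatten_pow p Y - schatten_pow p X - \<phi> (Y - X) \<and>
      p * (p - 1) / 2 * schatten_pow p (Y - X) powr (2 / p)
      \<le> (schatten_pow p Y - schatten_pow p X - \<phi> (Y - X))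
        * ((2 * schatten_pow p X + schatten_pow p Y) / 3) powr s"
    if Y: "Y \<in> carrier_mat m m" for Y
  proof -
    have YX: "Y - X \<in> carrier_mat m m" using X by (rule minus_carrier_mat)
    obtain V and mu :: "nat \<Rightarrow> real" where V: "unitary_mat ?n V"
      and Y_eq: "dilation m Y = V * mat_diag ?n (\<lambda>i. of_real (mu i)) * mat_adjoint V"
      and mu: "\<And>p. (\<Sum>i<m + m. \<bar>mu i\<bar> powr p) = 2 * schatten_pow p Y"
      using dilation_spectral[OF Y] by metis
    obtain W and \<beta> :: "nat \<Rightarrow> real" where W: "unitary_mat ?n W"
      and B_eq: "dilation m (Y - X) = W * mat_diag ?n (\<lambda>i. of_real (\<beta> i)) * mat_adjoint W"
      and \<beta>: "\<And>p. (\<Sum>i<m + m. \<bar>\<beta> i\<bar> powr p) = 2 * schatten_pow p (Y - X)"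
      using dilation_spectral[OF YX] by metis
    note VD = unitary_matD[OF V] and WD = unitary_matD[OF W]
    note cl = mult_carrier_mat[of _ ?n ?n _ ?n] assoc_mult_mat[of _ ?n ?n _ ?n _ ?n]
      left_mult_one_mat[of _ ?n ?n] right_mult_one_mat[of _ ?n ?n]
    define C where "C = mat_adjoint U * V"
    define a where "a = mat_adjoint U * W"
    define b where "b = mat_adjoint W * V"
    have Cu: "unitary_mat ?n C" and au: "unitary_mat ?n a" and bu: "unitary_mat ?n b"
      unfolding C_def a_def b_def by (intro unitary_mat_mult unitary_mat_adjoint U V W)+
    note CD = unitary_matD[OF Cu] and aD = unitary_matD[OF au] and bD = unitary_matD[OF bu]
    note carr = UD(1) VD(1) WD(1) mat_adjoint_carrier[OF UD(1)] mat_adjoint_carrier[OF VD(1)] mat_adjoint_carrier[OF WD(1)]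
    have dil_diff: "dilation m (Y - X) = dilation m Y - dilation m X"
    proof (rule eq_matI)
      fix i j assume "i < dim_row (dilation m Y - dilation m X)" "j < dim_col (dilation m Y - dilation m X)"
      then have "i < m + m" "j < m + m" using X Y by (simp_all add: dilation_def)
      then show "dilation m (Y - X) $$ (i, j) = (dilation m Y - dilation m X) $$ (i, j)"
        using X Y YX by (auto simp: dilation_def)
    qed (use X Y in \<open>auto simp: dilation_def\<close>)
    have YU: "mat_adjoint U * dilation m Y * V = C * mat_diag ?n (\<lambda>i. of_real (mu i))"
    proof -
      have "mat_adjoint U * dilation m Y * V = mat_adjoint U * V * mat_diag ?n (\<lambda>i. of_real (mu i)) * (mat_adjoint V * V)"
        unfolding Y_eq using carr by (simp add: cl)
      then show ?thesis using VD carr by (simp add: C_def cl)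
    qed
    have XU: "mat_adjoint U * dilation m X * V = mat_diag ?n (\<lambda>i. of_real (lam i)) * C"
    proof -
      have "mat_adjoint U * dilation m X * V = (mat_adjoint U * U) * mat_diag ?n (\<lambda>i. of_real (lam i)) * (mat_adjoint U * V)"
        unfolding X_eq using carr by (simp add: cl)
      then show ?thesis using UD carr by (simp add: C_def cl)
    qed
    \<comment> \<open>The dilation of Y - X between two bases, eigenvectors for X on the left and
      for Y on the right; \<open>a\<close> and \<open>b\<close> are the transitions to its own
      eigenvectors.\<close>
    define B where "B i j = (\<Sum>k<?n. \<beta> k * a $$ (i, k) * b $$ (k, j))" for i j
    have B_idx: "B i j = (mat_adjoint U * dilation m (Y - X) * V) $$ (i, j)" if "i < ?n" "j < ?n" for i j
    proof -
      have "mat_adjoint U * dilation m (Y - X) * V = (a * mat_diag ?n (\<lambda>i. of_real (\<beta> i))) * b"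
        unfolding B_eq a_def b_def using carr by (simp add: cl)
      also have "a * mat_diag ?n (\<lambda>i. of_real (\<beta> i)) = Matrix.mat ?n ?n (\<lambda>(i, j). a $$ (i, j) * of_real (\<beta> j))"
        by (rule mat_diag_mult_right[OF aD(1)])
      finally have eq: "mat_adjoint U * dilation m (Y - X) * V
          = Matrix.mat ?n ?n (\<lambda>(i, j). a $$ (i, j) * of_real (\<beta> j)) * b" .
      show ?thesis
        unfolding eq using that bD(1)
        by (subst index_mult_mat_sum[of _ ?n ?n _ ?n]) (auto simp: B_def mult_ac)
    qed
    \<comment> \<open>The dilation of X acts from the left as \<open>lam i\<close>, that of Y from
      the right as \<open>mu j\<close>. This turns the squares of eigenvalue differences, weighted
      by the squared moduli of \<open>C\<close>, into squared moduli of \<open>B\<close>.\<close>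
    have B_C: "B i j = (mu j - lam i) * C $$ (i, j)" if "i < ?n" "j < ?n" for i j
    proof -
      have "mat_adjoint U * dilation m (Y - X) * V = mat_adjoint U * dilation m Y * V - mat_adjoint U * dilation m X * V"
        unfolding dil_diff using carr
        by (simp add: mult_minus_distrib_mat[of _ ?n ?n _ ?n] minus_mult_distrib_mat[of _ ?n ?n _ _ ?n] mult_carrier_mat[of _ ?n ?n _ ?n])
      then show ?thesis
        using that CD(1) unfolding B_idx[OF that] YU XU mat_diag_mult_right[OF CD(1)] mat_diag_mult_left[OF CD(1)]
        by (simp add: algebra_simps)
    qed
    have C_row: "(\<Sum>j<?n. (cmod (C $$ (i, j)))\<^sup>2) = 1" if "i < ?n" for i
      using orthonormal_rows_row_norm[OF unitary_orthonormal_rows(1)[OF Cu] that] .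
    have C_col: "(\<Sum>i<?n. (cmod (C $$ (i, j)))\<^sup>2) = 1" if "j < ?n" for j
      using orthonormal_rows_row_norm[OF unitary_orthonormal_rows(2)[OF Cu] that] .
    have diag: "Re ((mat_adjoint U * dilation m (Y - X) * U) $$ (i, i))
        = (\<Sum>j<?n. (mu j - lam i) * (cmod (C $$ (i, j)))\<^sup>2)" if i: "i < ?n" for i
    proof -
      have "mat_adjoint U * dilation m (Y - X) * U = (mat_adjoint U * dilation m (Y - X) * V) * mat_adjoint C"
      proof -
        have "(mat_adjoint U * dilation m (Y - X) * V) * mat_adjoint C = mat_adjoint U * dilation m (Y - X) * (V * mat_adjoint V) * U"
          unfolding C_def using carr by (simp add: cl mat_adjoint_mult[of _ ?n ?n _ ?n])
        then show ?thesis using VD carr by (simp add: cl)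
      qed
      then have "(mat_adjoint U * dilation m (Y - X) * U) $$ (i, i) = (\<Sum>j<?n. B i j * cnj (C $$ (i, j)))"
        using i carr CD(1)
        by (simp only:) (subst index_mult_mat_sum[of _ ?n ?n _ ?n], auto simp: B_idx cl)
      also have "\<dots> = (\<Sum>j<?n. complex_of_real ((mu j - lam i) * (cmod (C $$ (i, j)))\<^sup>2))"
        using i by (intro sum.cong refl) (simp add: B_C complex_norm_square mult.assoc del: of_real_power)
      finally show ?thesis by (simp add: Re_sum del: of_real_mult)
    qed
    define R where "R = schatten_pow p Y - schatten_pow p X - \<phi> (Y - X)"
    \<comment> \<open>The squared moduli of the entries of \<open>C\<close> are doubly stochastic,
      so the pure powers recombine to the two Schatten powers; the first-order part is
      \<open>\<phi>\<close> by \<open>diag\<close>.\<close>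
    have R: "2 * R = (\<Sum>i<?n. \<Sum>j<?n. (cmod (C $$ (i, j)))\<^sup>2 * bregman p (lam i) (mu j))"
    proof -
      have "(\<Sum>i<?n. \<Sum>j<?n. (cmod (C $$ (i, j)))\<^sup>2 * \<bar>mu j\<bar> powr p) = (\<Sum>j<?n. \<Sum>i<?n. (cmod (C $$ (i, j)))\<^sup>2 * \<bar>mu j\<bar> powr p)"
        by (rule sum.swap)
      also have "\<dots> = 2 * schatten_pow p Y"
        using C_col by (simp add: mu flip: sum_distrib_right)
      finally have 1: "(\<Sum>i<?n. \<Sum>j<?n. (cmod (C $$ (i, j)))\<^sup>2 * \<bar>mu j\<bar> powr p) = 2 * schatten_pow p Y" .
      have 2: "(\<Sum>i<?n. \<Sum>j<?n. (cmod (C $$ (i, j)))\<^sup>2 * \<bar>lam i\<bar> powr p) = 2 * schatten_pow p X"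
        using C_row by (simp add: lam flip: sum_distrib_right)
      have 3: "(\<Sum>i<?n. \<Sum>j<?n. (cmod (C $$ (i, j)))\<^sup>2 * (p * h (lam i) * (mu j - lam i))) = 2 * \<phi> (Y - X)"
        by (simp add: \<phi>_def diag sum_distrib_left mult_ac)
      show ?thesis
        unfolding bregman_def h_def[symmetric] R_def
        using 1 2 3 by (simp add: right_diff_distrib sum_subtractf)
    qed
    have breg0: "0 \<le> bregman p x y" for x y
      by (rule order_trans[OF _ bregman_ge[OF p s]]) (use p in \<open>auto intro!: mult_nonneg_nonneg\<close>)
    have R0: "0 \<le> R"
    proof -
      have "0 \<le> 2 * R" unfolding R by (intro sum_nonneg mult_nonneg_nonneg breg0) auto
      then show ?thesis by simp
    qed
    have "p * (p - 1) / 2 * schatten_pow p (Y - X) powr (2 / p)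
      \<le> R * ((2 * schatten_pow p X + schatten_pow p Y) / 3) powr s"
    proof (cases "p = 1")
      case True
      then show ?thesis using R0 by simp
    next
      case False
      with p have p1: "1 < p" by simp
      \<comment> \<open>The weight of \<open>bregman_ge\<close> split into its row part
        \<open>d\<close> and its column part \<open>e\<close>.\<close>
      define d where "d i = 2 * \<bar>lam i\<bar> powr p / 3" for i
      define e where "e j = \<bar>mu j\<bar> powr p / 3" for j
      define T where "T = (\<Sum>i<?n. \<Sum>j<?n. (cmod (B i j))\<^sup>2 * (d i + e j) powr (- s))"
      define K where "K = (2 * schatten_pow p X + schatten_pow p Y) / 3"
      have K0: "0 \<le> K" by (simp add: K_def)
      have de: "(\<Sum>i<?n. d i) + (\<Sum>j<?n. e j) = 2 * K"
        unfolding d_def e_def K_def by (simp add: lam mu field_simps flip: sum_divide_distrib sum_distrib_left)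
      have "(\<Sum>k<?n. \<bar>\<beta> k\<bar> powr p) powr (2 / p) \<le> T * ((\<Sum>i<?n. d i) + (\<Sum>j<?n. e j)) powr s"
        unfolding T_def B_def
      proof (rule powr_norm_lower_bound[OF _ _ _ _ p1 p(2) s])
        show "orthonormal_rows ?n (\<lambda>k i. a $$ (i, k))" by (rule unitary_orthonormal_rows(2)[OF au])
        show "orthonormal_rows ?n (\<lambda>k j. b $$ (k, j))" by (rule unitary_orthonormal_rows(1)[OF bu])
        show "(\<Sum>k<?n. (cmod (a $$ (i, k)))\<^sup>2) = 1" if "i < ?n" for i
          using orthonormal_rows_row_norm[OF unitary_orthonormal_rows(1)[OF au] that] .
        show "(\<Sum>k<?n. (cmod (b $$ (k, j)))\<^sup>2) = 1" if "j < ?n" for j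
          using orthonormal_rows_row_norm[OF unitary_orthonormal_rows(2)[OF bu] that] .
        show "(\<Sum>k<?n. \<beta> k * a $$ (i, k) * b $$ (k, j)) = 0" if "i < ?n" "j < ?n" "d i + e j = 0" for i j
        proof -
          have "lam i = 0" "mu j = 0"
            using that(3) by (auto simp: d_def e_def add_nonneg_eq_0_iff)
          then show ?thesis using B_C[OF that(1,2)] by (simp add: B_def)
        qed
      qed (simp_all add: d_def e_def)
      \<comment> \<open>Doubling of the spectra contributes 2 times \<open>2 powr s\<close> on the
        left and \<open>2 powr s\<close> on the right. The remaining 2 meets the 2 in front of
        \<open>R\<close>.\<close>
      also have "(\<Sum>k<?n. \<bar>\<beta> k\<bar> powr p) powr (2 / p) = 2 powr (2 / p) * schatten_pow p (Y - X) powr (2 / p)"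
        by (simp add: \<beta> powr_mult)
      also have "2 powr (2 / p) = 2 * 2 powr s"
        using powr_add[of 2 1 s] by (simp add: s)
      also have "((\<Sum>i<?n. d i) + (\<Sum>j<?n. e j)) powr s = 2 powr s * K powr s"
        by (simp add: de powr_mult)
      finally have "2 powr s * (2 * schatten_pow p (Y - X) powr (2 / p)) \<le> 2 powr s * (T * K powr s)"
        by (simp add: mult_ac)
      then have 1: "2 * schatten_pow p (Y - X) powr (2 / p) \<le> T * K powr s"
        by (subst (asm) mult_le_cancel_left_pos) auto
      have 2: "p * (p - 1) / 2 * T \<le> 2 * R"
        unfolding R T_def sum_distrib_left
      proof (intro sum_mono)
        fix i j assume "i \<in> {..<?n}" "j \<in> {..<?n}"
        then have ij: "i < ?n" "j < ?n" by auto
        have "(cmod (B i j))\<^sup>2 = (mu j - lam i)\<^sup>2 * (cmod (C $$ (i, j)))\<^sup>2"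
          by (simp add: B_C[OF ij] norm_mult power_mult_distrib flip: of_real_diff)
        then have "p * (p - 1) / 2 * ((cmod (B i j))\<^sup>2 * (d i + e j) powr (- s))
          = (cmod (C $$ (i, j)))\<^sup>2 * (p * (p - 1) / 2 * (mu j - lam i)\<^sup>2 * ((2 * \<bar>lam i\<bar> powr p + \<bar>mu j\<bar> powr p) / 3) powr (- s))"
          by (simp add: d_def e_def add_divide_distrib mult_ac)
        also have "\<dots> \<le> (cmod (C $$ (i, j)))\<^sup>2 * bregman p (lam i) (mu j)"
          by (intro mult_left_mono bregman_ge[OF p s]) auto
        finally show "p * (p - 1) / 2 * ((cmod (B i j))\<^sup>2 * (d i + e j) powr (- s)) \<le> \<dots>" .
      qed
      have "2 * (p * (p - 1) / 2 * schatten_pow p (Y - X) powr (2 / p)) = p * (p - 1) / 2 * (2 * schatten_pow p (Y - X) powr (2 / p))"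
        by simp
      also have "\<dots> \<le> p * (p - 1) / 2 * (T * K powr s)"
        using 1 p by (intro mult_left_mono) auto
      also have "\<dots> = p * (p - 1) / 2 * T * K powr s" by simp
      also have "\<dots> \<le> 2 * R * K powr s"
        using 2 by (intro mult_right_mono) auto
      finally show ?thesis by (simp add: K_def)
    qed
    then show ?thesis using R0 by (simp add: R_def)
  qed
  show ?thesis using that[of \<phi>] \<phi>_sum main by blast
qed

section \<open>Uniform convexity\<close>

lemma schatten_pow_smult:
  assumes M: "M \<in> carrier_mat m m" and c: "cmod c = 1"
  shows "schatten_pow p (c \<cdot>\<^sub>m M) = schatten_pow p M"
proof -
  have "c * cnj c = 1" using c by (simp flip: complex_norm_square)
  then have cc: "c * (cnj c * z) = z" for z by (simp flip: mult.assoc)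
  have "mat_adjoint (c \<cdot>\<^sub>m M) * (c \<cdot>\<^sub>m M) = mat_adjoint M * M"
    using M by (intro eq_matI) (auto simp: scalar_prod_def mult_ac cc)
  then show ?thesis by (simp add: schatten_pow_def singular_values_def)
qed

text \<open>Summing \<open>schatten_bregman\<close> at X = A x over y removes \<open>\<phi>\<close>,
  because the deviations from A x sum to 0. Hoelder's inequality over all pairs (x, y) then yields
  one inequality between sums, and \<open>power_gap\<close> turns the difference S - SA into a
  difference of powers. The parameter x stands for the remaining variables. Only y is averaged: a
  normalisation of \<Omega> would multiply every term by the same factor.\<close>

lemma schatten_pow_uniform_convexity:
  fixes F :: "'a \<Rightarrow> nat \<Rightarrow> complex mat" and A :: "'a \<Rightarrow> complex mat"
  assumes p: "1 \<le> p" "p \<le> 2" and \<Omega>: "finite \<Omega>" and r: "0 < r"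
    and F: "\<And>x y. x \<in> \<Omega> \<Longrightarrow> y < r \<Longrightarrow> F x y \<in> carrier_mat m m"
    and A: "\<And>x. x \<in> \<Omega> \<Longrightarrow> A x \<in> carrier_mat m m"
    and A_eq: "\<And>x i j. x \<in> \<Omega> \<Longrightarrow> i < m \<Longrightarrow> j < m \<Longrightarrow> (\<Sum>y<r. F x y $$ (i, j)) = of_nat r * A x $$ (i, j)"
  shows "(\<Sum>x\<in>\<Omega>. schatten_pow p (A x)) powr (2 / p)
      + (p - 1) * ((\<Sum>x\<in>\<Omega>. \<Sum>y<r. schatten_pow p (F x y - A x)) / r) powr (2 / p)
    \<le> ((\<Sum>x\<in>\<Omega>. \<Sum>y<r. schatten_pow p (F x y)) / r) powr (2 / p)"
proof -
  define s where "s = 2 / p - 1"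
  have s0: "0 \<le> s" and s1: "1 + s = 2 / p" using p by (simp_all add: s_def)
  let ?P = "\<lambda>X. schatten_pow p X"
  define S where "S = (\<Sum>x\<in>\<Omega>. \<Sum>y<r. ?P (F x y)) / r"
  define SA where "SA = (\<Sum>x\<in>\<Omega>. ?P (A x))"
  define SB where "SB = (\<Sum>x\<in>\<Omega>. \<Sum>y<r. ?P (F x y - A x)) / r"
  have "\<exists>\<phi>. (\<Sum>y<r. \<phi> (F x y - A x)) = 0 \<and>
      (\<forall>Y\<in>carrier_mat m m. 0 \<le> ?P Y - ?P (A x) - \<phi> (Y - A x) \<and>
        p * (p - 1) / 2 * ?P (Y - A x) powr (2 / p)
          \<le> (?P Y - ?P (A x) - \<phi> (Y - A x)) * ((2 * ?P (A x) + ?P Y) / 3) powr s)"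
    if x: "x \<in> \<Omega>" for x
  proof -
    from schatten_bregman[OF p s_def A[OF x]] obtain \<phi> where
      \<phi>: "\<And>(I :: nat set) G. (\<And>y. y \<in> I \<Longrightarrow> G y \<in> carrier_mat m m) \<Longrightarrow>
        (\<And>i j. i < m \<Longrightarrow> j < m \<Longrightarrow> (\<Sum>y\<in>I. G y $$ (i, j)) = 0) \<Longrightarrow> (\<Sum>y\<in>I. \<phi> (G y)) = 0"
      and rest: "\<And>Y. Y \<in> carrier_mat m m \<Longrightarrow> 0 \<le> ?P Y - ?P (A x) - \<phi> (Y - A x)"
        "\<And>Y. Y \<in> carrier_mat m m \<Longrightarrow> p * (p - 1) / 2 * ?P (Y - A x) powr (2 / p)
          \<le> (?P Y - ?P (A x) - \<phi> (Y - A x)) * ((2 * ?P (A x) + ?P Y) / 3) powr s"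
      by blast
    have "(\<Sum>y\<in>{..<r}. \<phi> (F x y - A x)) = 0"
    proof (rule \<phi>)
      show "F x y - A x \<in> carrier_mat m m" for y using A[OF x] by (rule minus_carrier_mat)
      fix i j assume ij: "i < m" "j < m"
      have "(\<Sum>y<r. (F x y - A x) $$ (i, j)) = (\<Sum>y<r. F x y $$ (i, j) - A x $$ (i, j))"
        using A[OF x] ij by (intro sum.cong refl) auto
      then show "(\<Sum>y<r. (F x y - A x) $$ (i, j)) = 0"
        using A_eq[OF x ij] by (simp add: sum_subtractf)
    qed
    then show ?thesis using rest by blast
  qed
  then obtain \<phi> where \<phi>0: "\<And>x. x \<in> \<Omega> \<Longrightarrow> (\<Sum>y<r. \<phi> x (F x y - A x)) = 0"
    and \<phi>1: "\<And>x Y. x \<in> \<Omega> \<Longrightarrow> Y \<in> carrier_mat m m \<Longrightarrow> 0 \<le> ?P Y - ?P (A x) - \<phi> x (Y - A x)"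
    and \<phi>2: "\<And>x Y. x \<in> \<Omega> \<Longrightarrow> Y \<in> carrier_mat m m \<Longrightarrow> p * (p - 1) / 2 * ?P (Y - A x) powr (2 / p)
          \<le> (?P Y - ?P (A x) - \<phi> x (Y - A x)) * ((2 * ?P (A x) + ?P Y) / 3) powr s"
    by metis
  define R where "R z = ?P (F (fst z) (snd z)) - ?P (A (fst z)) - \<phi> (fst z) (F (fst z) (snd z) - A (fst z))" for z
  define K where "K z = (2 * ?P (A (fst z)) + ?P (F (fst z) (snd z))) / 3" for z
  define B where "B z = F (fst z) (snd z) - A (fst z)" for z
  let ?I = "\<Omega> \<times> {..<r}"
  have fin: "finite ?I" using \<Omega> by simp
  have R0: "0 \<le> R z" if "z \<in> ?I" for z using \<phi>1 F that by (auto simp: R_def)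
  have K0: "0 \<le> K z" for z by (simp add: K_def)
  have RK: "p * (p - 1) / 2 * ?P (B z) powr (2 / p) \<le> R z * K z powr s" if "z \<in> ?I" for z
    using \<phi>2 F that by (auto simp: R_def K_def B_def)
  have pair: "(\<Sum>z\<in>?I. h (fst z) (snd z)) = (\<Sum>x\<in>\<Omega>. \<Sum>y<r. h x y)" for h :: "'a \<Rightarrow> nat \<Rightarrow> real"
    by (simp add: sum.cartesian_product case_prod_unfold)
  have rS: "(\<Sum>x\<in>\<Omega>. \<Sum>y<r. ?P (F x y)) = r * S" using r by (simp add: S_def)
  have sumR: "(\<Sum>z\<in>?I. R z) / r = S - SA"
  proof -
    have "(\<Sum>z\<in>?I. R z) = (\<Sum>x\<in>\<Omega>. \<Sum>y<r. ?P (F x y) - ?P (A x) - \<phi> x (F x y - A x))"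
      unfolding R_def by (rule pair)
    also have "\<dots> = r * S - r * SA"
      using \<phi>0 by (simp add: sum_subtractf rS SA_def sum_distrib_left)
    finally show ?thesis using r by (simp add: field_simps)
  qed
  have sumK: "(\<Sum>z\<in>?I. K z) / r = (2 * SA + S) / 3"
  proof -
    have "(\<Sum>z\<in>?I. K z) = (\<Sum>x\<in>\<Omega>. \<Sum>y<r. (2 * ?P (A x) + ?P (F x y)) / 3)"
      unfolding K_def by (rule pair)
    also have "\<dots> = (2 * (r * SA) + r * S) / 3"
      by (simp add: sum_divide_distrib[symmetric] sum.distrib rS SA_def sum_distrib_left mult_ac)
    finally show ?thesis using r by (simp add: field_simps)
  qed
  have sumB: "(\<Sum>z\<in>?I. ?P (B z)) / r = SB"
    unfolding B_def SB_def by (subst pair) simp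
  have SA0: "0 \<le> SA" and SB0: "0 \<le> SB" unfolding SA_def SB_def by (auto intro!: sum_nonneg divide_nonneg_nonneg)
  have SAS: "SA \<le> S"
  proof -
    have "0 \<le> (\<Sum>z\<in>?I. R z) / r" using R0 by (intro divide_nonneg_nonneg sum_nonneg) auto
    then show ?thesis using sumR by simp
  qed
  define c where "c = p * (p - 1) / 2"
  have c0: "0 \<le> c" using p by (simp add: c_def)
  have key: "c * SB powr (2 / p) \<le> (S - SA) * ((2 * SA + S) / 3) powr s"
  proof (cases "p = 1")
    case True
    then show ?thesis using SAS by (simp add: c_def)
  next
    case False
    with p have p1: "1 < p" by simp
    then have c: "0 < c" by (simp add: c_def)
    have sp: "s * (p / 2) = 1 - p / 2" using p1 by (simp add: s_def field_simps)
    \<comment> \<open>Raising to the power p / 2 makes the left side linear in the Schatten power of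
      the deviation, so that it can be summed.\<close>
    have pt: "c powr (p / 2) * ?P (B z) \<le> R z powr (p / 2) * K z powr (1 - p / 2)" if z: "z \<in> ?I" for z
    proof -
      have "(c * ?P (B z) powr (2 / p)) powr (p / 2) \<le> (R z * K z powr s) powr (p / 2)"
        using RK[OF z] p1 c0 unfolding c_def[symmetric] by (intro powr_mono2) auto
      also have "\<dots> = R z powr (p / 2) * K z powr (1 - p / 2)"
        by (simp only: powr_mult powr_powr sp)
      also have "(c * ?P (B z) powr (2 / p)) powr (p / 2) = c powr (p / 2) * ?P (B z)"
        using p1 by (simp add: powr_mult powr_powr)
      finally show ?thesis .
    qed
    have "c powr (p / 2) * SB \<le> (S - SA) powr (p / 2) * ((2 * SA + S) / 3) powr (1 - p / 2)"
    \<comment> \<open>At p = 2 the second Hoelder exponent 1 - p / 2 degenerates to 0 and plain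
      summation is enough.\<close>
    proof (cases "p = 2")
      case True
      have "c powr (p / 2) * SB = (\<Sum>z\<in>?I. c powr (p / 2) * ?P (B z)) / r"
        by (simp add: sumB[symmetric] sum_distrib_left)
      also have "\<dots> \<le> (\<Sum>z\<in>?I. R z) / r"
      proof (intro divide_right_mono sum_mono)
        fix z assume z: "z \<in> ?I"
        have "K z powr 0 \<le> 1" by simp
        then have "R z * K z powr 0 \<le> R z * 1" using R0[OF z] by (intro mult_left_mono) auto
        then show "c powr (p / 2) * ?P (B z) \<le> R z"
          using pt[OF z] R0[OF z] True by simp
      qed simp
      also have "\<dots> = S - SA" by (rule sumR)
      also have "\<dots> \<le> (S - SA) powr (p / 2) * ((2 * SA + S) / 3) powr (1 - p / 2)"
        using True SAS SA0 by (cases "2 * SA + S = 0") auto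
      finally show ?thesis .
    next
      case False
      with p have p2: "p < 2" by simp
      have "c powr (p / 2) * SB = (\<Sum>z\<in>?I. c powr (p / 2) * ?P (B z)) / r"
        by (simp add: sumB[symmetric] sum_distrib_left)
      also have "\<dots> \<le> (\<Sum>z\<in>?I. R z powr (p / 2) * K z powr (1 - p / 2)) / r"
        using pt by (intro divide_right_mono sum_mono) auto
      also have "\<dots> \<le> ((\<Sum>z\<in>?I. R z) powr (p / 2) * (\<Sum>z\<in>?I. K z) powr (1 - p / 2)) / r"
        using fin R0 K0 p1 p2 by (intro divide_right_mono sum_powr_Holder) auto
      also have "\<dots> = ((\<Sum>z\<in>?I. R z) / r) powr (p / 2) * ((\<Sum>z\<in>?I. K z) / r) powr (1 - p / 2)"
      proof -
        have "real r = r powr (p / 2) * r powr (1 - p / 2)" using r by (simp flip: powr_add)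
        then show ?thesis by (simp add: powr_divide)
      qed
      finally show ?thesis by (simp only: sumR sumK)
    qed
    then have "(c powr (p / 2) * SB) powr (2 / p) \<le> ((S - SA) powr (p / 2) * ((2 * SA + S) / 3) powr (1 - p / 2)) powr (2 / p)"
      using p1 SB0 by (intro powr_mono2) auto
    moreover have "(c powr (p / 2) * SB) powr (2 / p) = c * SB powr (2 / p)"
      using p1 c by (simp add: powr_mult powr_powr)
    moreover have "((S - SA) powr (p / 2) * ((2 * SA + S) / 3) powr (1 - p / 2)) powr (2 / p) = (S - SA) * ((2 * SA + S) / 3) powr s"
    proof -
      have "(1 - p / 2) * (2 / p) = s" using p1 by (simp add: s_def field_simps)
      then have "(((2 * SA + S) / 3) powr (1 - p / 2)) powr (2 / p) = ((2 * SA + S) / 3) powr s" by (simp only: powr_powr)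
      moreover have "((S - SA) powr (p / 2)) powr (2 / p) = S - SA" using p1 SAS by (simp add: powr_powr)
      ultimately show ?thesis by (simp only: powr_mult)
    qed
    ultimately show ?thesis by simp
  qed
  have "(p - 1) * SB powr (2 / p) = (1 + s) * (c * SB powr (2 / p))"
    using p by (simp add: s1 c_def)
  also have "\<dots> \<le> (1 + s) * ((S - SA) * ((2 * SA + S) / 3) powr s)"
    using key s0 by (intro mult_left_mono) auto
  also have "\<dots> \<le> S powr (1 + s) - SA powr (1 + s)"
    by (rule power_gap[OF SA0 SAS s0])
  finally show ?thesis by (simp add: s1 S_def SA_def SB_def)
qed

section \<open>Hypercontractivity\<close>

text \<open>The power of \<open>omega r\<close> with exponent - k. Conjugation inverts a root of
  unity, so the exponent stays a natural number.\<close>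

definition unit_char :: "nat \<Rightarrow> nat \<Rightarrow> complex" where
  "unit_char r k = cnj (omega r) ^ k"

lemma cmod_unit_char [simp]: "cmod (unit_char r k) = 1"
  by (simp add: unit_char_def omega_def norm_power)

lemma unit_char_cnj [simp]: "unit_char r k * cnj (unit_char r k) = 1"
  by (simp flip: complex_norm_square)

lemma unit_char_add: "unit_char r (k + l) = unit_char r k * unit_char r l"
  by (simp add: unit_char_def power_add)

lemma omega_powi: "omega r powi (- int k) = unit_char r k"
proof -
  have "inverse (omega r) = cnj (omega r)"
    by (simp add: omega_def exp_cnj exp_minus[symmetric])
  then show ?thesis by (simp add: unit_char_def power_int_minus flip: power_inverse)
qed

lemma cnj_omega_power: "cnj (omega r) ^ k = cnj (exp (2 * of_real pi * \<i> * of_nat k / of_nat r))"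
proof -
  have "omega r ^ k = exp (2 * of_real pi * \<i> * of_nat k / of_nat r)"
    by (simp add: omega_def exp_of_nat_mult[symmetric] mult_ac)
  then show ?thesis by (simp only: complex_cnj_power[symmetric])
qed

lemma unit_char_eq_iff:
  assumes "0 < r"
  shows "unit_char r k = unit_char r l \<longleftrightarrow> k mod r = l mod r"
  using complex_root_unity_eq[of r k l] assms
  by (simp add: unit_char_def cnj_omega_power cong_def)

lemma unit_char_mod: "0 < r \<Longrightarrow> unit_char r (k mod r) = unit_char r k"
  by (simp add: unit_char_eq_iff)

lemma unit_char_orthogonal:
  assumes "t < r" "u < r" "t \<noteq> u"
  shows "(\<Sum>y<r. cnj (unit_char r (t * y)) * unit_char r (u * y)) = 0"
proof -
  define z where "z = cnj (unit_char r t) * unit_char r u"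
  have r: "0 < r" using assms by simp
  have "unit_char r t \<noteq> unit_char r u" using unit_char_eq_iff[OF r] assms by simp
  moreover have "unit_char r t * z = unit_char r u" by (simp add: z_def flip: mult.assoc)
  ultimately have z1: "z \<noteq> 1" by auto
  have pow: "unit_char r (k * y) = unit_char r k ^ y" for k y
    by (simp add: unit_char_def power_mult)
  have "unit_char r (k * r) = 1" for k
    using unit_char_eq_iff[OF r, of "k * r" 0] by (simp add: unit_char_def)
  then have zr: "z ^ r = 1"
    by (simp add: z_def power_mult_distrib flip: pow complex_cnj_power)
  have "(\<Sum>y<r. cnj (unit_char r (t * y)) * unit_char r (u * y)) = (\<Sum>y<r. z ^ y)"
    by (simp add: pow z_def power_mult_distrib)
  also have "\<dots> = 0" using geometric_sum[OF z1, of r] zr by simp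
  finally show ?thesis .
qed

section \<open>Splitting off frequencies in one coordinate\<close>

definition char_coeff :: "nat \<Rightarrow> nat \<Rightarrow> (nat \<Rightarrow> complex mat) \<Rightarrow> nat \<Rightarrow> complex mat" where
  "char_coeff r m F t = Matrix.mat m m (\<lambda>(i, j). 1 / of_nat r * (\<Sum>y<r. F y $$ (i, j) * unit_char r (t * y)))"

lemma char_coeff_carrier [simp]: "char_coeff r m F t \<in> carrier_mat m m"
  by (simp add: char_coeff_def)

text \<open>The projection of F onto functions without frequency t. The conjugate of
  \<open>unit_char\<close> is the character with which the coefficient at t reappears in Fourier
  inversion.\<close>

definition char_remove :: "nat \<Rightarrow> nat \<Rightarrow> nat \<Rightarrow> (nat \<Rightarrow> complex mat) \<Rightarrow> nat \<Rightarrow> complex mat" where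
  "char_remove r m t F y = F y - cnj (unit_char r (t * y)) \<cdot>\<^sub>m char_coeff r m F t"

lemma char_remove_carrier [simp]: "char_remove r m t F y \<in> carrier_mat m m"
  unfolding char_remove_def by (intro minus_carrier_mat smult_carrier_mat) simp

lemma char_coeff_remove:
  assumes F: "\<And>y. y < r \<Longrightarrow> F y \<in> carrier_mat m m" and t: "t < r" "u < r" "t \<noteq> u"
  shows "char_coeff r m (char_remove r m t F) u = char_coeff r m F u"
proof (rule eq_matI)
  fix i j assume "i < dim_row (char_coeff r m F u)" "j < dim_col (char_coeff r m F u)"
  then have ij: "i < m" "j < m" by (auto simp: char_coeff_def)
  let ?g = "char_coeff r m F t $$ (i, j)"
  have "(\<Sum>y<r. char_remove r m t F y $$ (i, j) * unit_char r (u * y))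
      = (\<Sum>y<r. F y $$ (i, j) * unit_char r (u * y) - ?g * (cnj (unit_char r (t * y)) * unit_char r (u * y)))"
    using ij by (intro sum.cong refl) (auto simp: char_remove_def char_coeff_def[of r m F t] algebra_simps)
  also have "\<dots> = (\<Sum>y<r. F y $$ (i, j) * unit_char r (u * y))"
    using unit_char_orthogonal[OF t] by (simp add: sum_subtractf flip: sum_distrib_left)
  finally show "char_coeff r m (char_remove r m t F) u $$ (i, j) = char_coeff r m F u $$ (i, j)"
    using ij by (simp add: char_coeff_def)
qed (auto simp: char_coeff_def)

text \<open>Multiplication by the character moves frequency t to 0, so the average of
  \<open>H x\<close> over y is the coefficient of \<open>F x\<close> at t. A unimodular factor
  leaves Schatten norms unchanged: \<open>H\<close> has the norms of \<open>F\<close>, and its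
  deviation from the average those of \<open>char_remove\<close>.\<close>

lemma schatten_pow_remove:
  fixes F :: "'a \<Rightarrow> nat \<Rightarrow> complex mat"
  assumes p: "1 \<le> p" "p \<le> 2" and \<Omega>: "finite \<Omega>" and t: "t < r"
    and F: "\<And>x y. x \<in> \<Omega> \<Longrightarrow> y < r \<Longrightarrow> F x y \<in> carrier_mat m m"
  shows "(\<Sum>x\<in>\<Omega>. schatten_pow p (char_coeff r m (F x) t)) powr (2 / p)
      + (p - 1) * ((\<Sum>x\<in>\<Omega>. \<Sum>y<r. schatten_pow p (char_remove r m t (F x) y)) / r) powr (2 / p)
    \<le> ((\<Sum>x\<in>\<Omega>. \<Sum>y<r. schatten_pow p (F x y)) / r) powr (2 / p)"
proof -
  define H where "H x y = unit_char r (t * y) \<cdot>\<^sub>m F x y" for x y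
  have H: "H x y \<in> carrier_mat m m" if "x \<in> \<Omega>" "y < r" for x y
    using F[OF that] by (simp add: H_def)
  have HF: "schatten_pow p (H x y) = schatten_pow p (F x y)" if "x \<in> \<Omega>" "y < r" for x y
    unfolding H_def by (rule schatten_pow_smult[OF F[OF that]]) simp
  have Hdiff: "schatten_pow p (H x y - char_coeff r m (F x) t) = schatten_pow p (char_remove r m t (F x) y)"
    if "x \<in> \<Omega>" "y < r" for x y
  proof -
    have "H x y - char_coeff r m (F x) t = unit_char r (t * y) \<cdot>\<^sub>m char_remove r m t (F x) y"
      using carrier_matD[OF F[OF that]] carrier_matD[OF char_coeff_carrier[of r m "F x" t]]
      by (intro eq_matI) (auto simp: H_def char_remove_def right_diff_distrib simp flip: mult.assoc)
    then show ?thesis by (simp add: schatten_pow_smult[OF char_remove_carrier])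
  qed
  have "(\<Sum>x\<in>\<Omega>. schatten_pow p (char_coeff r m (F x) t)) powr (2 / p)
      + (p - 1) * ((\<Sum>x\<in>\<Omega>. \<Sum>y<r. schatten_pow p (H x y - char_coeff r m (F x) t)) / r) powr (2 / p)
    \<le> ((\<Sum>x\<in>\<Omega>. \<Sum>y<r. schatten_pow p (H x y)) / r) powr (2 / p)"
  proof (rule schatten_pow_uniform_convexity[OF p \<Omega> _ H])
    fix x i j assume "x \<in> \<Omega>" "i < m" "j < m"
    then have "(\<Sum>y<r. H x y $$ (i, j)) = (\<Sum>y<r. F x y $$ (i, j) * unit_char r (t * y))"
      by (intro sum.cong refl) (auto simp: H_def carrier_matD[OF F])
    then show "(\<Sum>y<r. H x y $$ (i, j)) = of_nat r * char_coeff r m (F x) t $$ (i, j)"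
      using \<open>i < m\<close> \<open>j < m\<close> t by (simp add: char_coeff_def)
  qed (use t in auto)
  then show ?thesis by (simp add: HF Hdiff)
qed

text \<open>The remainder after one removal keeps the coefficients at all other frequencies, so the
  bound applies to it again, discounted by p - 1. What is left after the last frequency is bounded
  below by 0.\<close>

lemma schatten_pow_remove_list:
  fixes F :: "'a \<Rightarrow> nat \<Rightarrow> complex mat"
  assumes p: "1 \<le> p" "p \<le> 2" and \<Omega>: "finite \<Omega>"
    and F: "\<And>x y. x \<in> \<Omega> \<Longrightarrow> y < r \<Longrightarrow> F x y \<in> carrier_mat m m"
    and L: "distinct L" "set L \<subseteq> {..<r}"
  shows "(\<Sum>k<length L. (p - 1) ^ k * (\<Sum>x\<in>\<Omega>. schatten_pow p (char_coeff r m (F x) (L ! k))) powr (2 / p))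
    \<le> ((\<Sum>x\<in>\<Omega>. \<Sum>y<r. schatten_pow p (F x y)) / r) powr (2 / p)"
  using F L
proof (induction L arbitrary: F)
  case Nil
  then show ?case by simp
next
  case (Cons t L)
  let ?F' = "\<lambda>x. char_remove r m t (F x)"
  have t: "t < r" using Cons.prems by simp
  have coeff: "char_coeff r m (?F' x) (L ! k) = char_coeff r m (F x) (L ! k)" if "x \<in> \<Omega>" "k < length L" for x k
  proof (rule char_coeff_remove)
    have "L ! k \<in> set L" using that by simp
    then show "L ! k < r" "t \<noteq> L ! k" using Cons.prems by auto
  qed (use t that Cons.prems in auto)
  have "(\<Sum>k<length L. (p - 1) ^ k * (\<Sum>x\<in>\<Omega>. schatten_pow p (char_coeff r m (F x) (L ! k))) powr (2 / p))
      = (\<Sum>k<length L. (p - 1) ^ k * (\<Sum>x\<in>\<Omega>. schatten_pow p (char_coeff r m (?F' x) (L ! k))) powr (2 / p))"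
    using coeff by simp
  also have "\<dots> \<le> ((\<Sum>x\<in>\<Omega>. \<Sum>y<r. schatten_pow p (?F' x y)) / r) powr (2 / p)"
    using Cons.prems by (intro Cons.IH) auto
  finally have IH: "(p - 1) * (\<Sum>k<length L. (p - 1) ^ k * (\<Sum>x\<in>\<Omega>. schatten_pow p (char_coeff r m (F x) (L ! k))) powr (2 / p))
      \<le> (p - 1) * ((\<Sum>x\<in>\<Omega>. \<Sum>y<r. schatten_pow p (?F' x y)) / r) powr (2 / p)"
    using p by (intro mult_left_mono) auto
  have "(\<Sum>k<length (t # L). (p - 1) ^ k * (\<Sum>x\<in>\<Omega>. schatten_pow p (char_coeff r m (F x) ((t # L) ! k))) powr (2 / p))
      = (\<Sum>x\<in>\<Omega>. schatten_pow p (char_coeff r m (F x) t)) powr (2 / p)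
        + (p - 1) * (\<Sum>k<length L. (p - 1) ^ k * (\<Sum>x\<in>\<Omega>. schatten_pow p (char_coeff r m (F x) (L ! k))) powr (2 / p))"
    unfolding length_Cons sum.lessThan_Suc_shift by (simp add: sum_distrib_left mult.assoc)
  also have "\<dots> \<le> ((\<Sum>x\<in>\<Omega>. \<Sum>y<r. schatten_pow p (F x y)) / r) powr (2 / p)"
    using schatten_pow_remove[where F = F, OF p \<Omega> t Cons.prems(1)] IH by linarith
  finally show ?case .
qed

lemma sum_shift_mod:
  fixes g :: "nat \<Rightarrow> real"
  shows "(\<Sum>j<q. g ((j + k) mod q)) = (\<Sum>t<q. g t)"
proof (induction k)
  case (Suc k)
  define h where "h j = g ((j + k) mod q)" for j
  have "h 0 + (\<Sum>j<q. h (Suc j)) = (\<Sum>j<q. h j) + h q"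
    by (simp flip: sum.lessThan_Suc_shift)
  moreover have "h q = h 0" by (simp add: h_def)
  ultimately show ?case using Suc by (simp add: h_def)
next
  case 0
  show ?case by (intro sum.cong refl) simp
qed

text \<open>Removing the frequencies in the order \<open>0, t\<^sub>1, t\<^sub>2, ...\<close> gives \<open>t\<^sub>k\<close> the factor \<open>(p - 1)\<^sup>k\<close>.
  Averaging over the cyclic rotations of \<open>1, ..., r - 1\<close> gives every nonzero frequency the mean of
  these factors, which is the square of \<open>rho_bound\<close>.\<close>

lemma schatten_pow_one_coordinate:
  fixes F :: "'a \<Rightarrow> nat \<Rightarrow> complex mat"
  assumes p: "1 \<le> p" "p \<le> 2" and r: "2 \<le> r" and \<Omega>: "finite \<Omega>"
    and F: "\<And>x y. x \<in> \<Omega> \<Longrightarrow> y < r \<Longrightarrow> F x y \<in> carrier_mat m m"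
    and \<kappa>: "(real r - 1) * \<kappa> \<le> (\<Sum>k<r - 1. (p - 1) ^ Suc k)"
  shows "(\<Sum>t<r. (if t = 0 then 1 else \<kappa>) * (\<Sum>x\<in>\<Omega>. schatten_pow p (char_coeff r m (F x) t)) powr (2 / p))
    \<le> ((\<Sum>x\<in>\<Omega>. \<Sum>y<r. schatten_pow p (F x y)) / r) powr (2 / p)"
proof -
  define V where "V t = (\<Sum>x\<in>\<Omega>. schatten_pow p (char_coeff r m (F x) t)) powr (2 / p)" for t
  define T where "T = ((\<Sum>x\<in>\<Omega>. \<Sum>y<r. schatten_pow p (F x y)) / r) powr (2 / p)"
  define q where "q = r - 1"
  have q: "r = Suc q" "0 < q" using r by (auto simp: q_def)
  have V0: "0 \<le> V t" for t by (simp add: V_def)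
  have step: "V 0 + (\<Sum>k<q. (p - 1) ^ Suc k * V (Suc ((j + k) mod q))) \<le> T" for j
  proof -
    \<comment> \<open>Frequency 0 is always removed first and keeps the factor 1; only 1, ..., r - 1
      are rotated. This list starts at 1, hence the \<open>Suc\<close> around the index modulo
      q.\<close>
    define L where "L = rotate j [1..<r]"
    have len: "length L = q" by (simp add: L_def q_def)
    have nth: "L ! k = Suc ((j + k) mod q)" if "k < q" for k
      using that q by (simp add: L_def nth_rotate del: upt_Suc)
    have "(\<Sum>k<length (0 # L). (p - 1) ^ k * V ((0 # L) ! k)) \<le> T"
      unfolding V_def T_def
      by (rule schatten_pow_remove_list[OF p \<Omega> F]) (use r in \<open>auto simp: L_def\<close>)
    also have "(\<Sum>k<length (0 # L). (p - 1) ^ k * V ((0 # L) ! k)) = V 0 + (\<Sum>k<q. (p - 1) ^ Suc k * V (Suc ((j + k) mod q)))"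
      unfolding length_Cons sum.lessThan_Suc_shift len by (simp add: nth)
    finally show ?thesis .
  qed
  have "(\<Sum>j<q. V 0 + (\<Sum>k<q. (p - 1) ^ Suc k * V (Suc ((j + k) mod q)))) \<le> (\<Sum>j<q. T)"
    by (intro sum_mono step)
  also have "(\<Sum>j<q. V 0 + (\<Sum>k<q. (p - 1) ^ Suc k * V (Suc ((j + k) mod q))))
      = q * V 0 + (\<Sum>k<q. \<Sum>j<q. (p - 1) ^ Suc k * V (Suc ((j + k) mod q)))"
    by (subst sum.swap) (simp add: sum.distrib)
  also have "(\<Sum>k<q. \<Sum>j<q. (p - 1) ^ Suc k * V (Suc ((j + k) mod q))) = (\<Sum>k<q. (p - 1) ^ Suc k * (\<Sum>t<q. V (Suc t)))"
    unfolding sum_distrib_left[symmetric] by (intro sum.cong refl arg_cong2[where f = "(*)"] sum_shift_mod)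
  also have "\<dots> = (\<Sum>k<q. (p - 1) ^ Suc k) * (\<Sum>t<q. V (Suc t))"
    by (simp only: sum_distrib_right)
  finally have le: "q * V 0 + (\<Sum>k<q. (p - 1) ^ Suc k) * (\<Sum>t<q. V (Suc t)) \<le> q * T" by simp
  have "(q * \<kappa>) * (\<Sum>t<q. V (Suc t)) \<le> (\<Sum>k<q. (p - 1) ^ Suc k) * (\<Sum>t<q. V (Suc t))"
    using \<kappa> V0 q by (intro mult_right_mono sum_nonneg) auto
  with le have "q * (V 0 + \<kappa> * (\<Sum>t<q. V (Suc t))) \<le> q * T" by (simp add: algebra_simps)
  then have "V 0 + \<kappa> * (\<Sum>t<q. V (Suc t)) \<le> T" using q by simp
  moreover have "(\<Sum>t<r. (if t = 0 then 1 else \<kappa>) * V t) = V 0 + \<kappa> * (\<Sum>t<q. V (Suc t))"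
    unfolding q(1) sum.lessThan_Suc_shift by (simp add: sum_distrib_left)
  ultimately show ?thesis by (simp add: V_def T_def)
qed

section \<open>Induction on the number of coordinates\<close>

lemma sum_Zr_power_Suc:
  fixes h :: "(nat \<Rightarrow> nat) \<Rightarrow> 'b :: comm_monoid_add"
  shows "(\<Sum>x\<in>Zr_power r (Suc n). h x) = (\<Sum>x\<in>Zr_power r n. \<Sum>y<r. h (x(n := y)))"
proof -
  have "Zr_power r (Suc n) = (\<lambda>(y, x). x(n := y)) ` ({..<r} \<times> Zr_power r n)"
    unfolding Zr_power_def lessThan_Suc PiE_insert_eq ..
  moreover have "inj_on (\<lambda>(y, x). x(n := y)) ({..<r} \<times> Zr_power r n)"
    using inj_combinator[of n "{..<n}" "\<lambda>_. {..<r}"] by (simp add: Zr_power_def)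
  ultimately have "(\<Sum>x\<in>Zr_power r (Suc n). h x) = (\<Sum>(y, x)\<in>{..<r} \<times> Zr_power r n. h (x(n := y)))"
    by (simp add: sum.reindex case_prod_unfold)
  also have "\<dots> = (\<Sum>x\<in>Zr_power r n. \<Sum>y<r. h (x(n := y)))"
    by (simp add: sum.cartesian_product[symmetric] sum.swap[of _ "Zr_power r n"])
  finally show ?thesis .
qed

lemma finite_Zr_power [simp]: "finite (Zr_power r n)"
  by (simp add: Zr_power_def finite_PiE)

lemma supp_size_upd: "supp_size (Suc n) (S(n := t)) = supp_size n S + (if t = 0 then 0 else 1)"
proof (cases "t = 0")
  case True
  then have "{i \<in> {..<Suc n}. (S(n := t)) i \<noteq> 0} = {i \<in> {..<n}. S i \<noteq> 0}" by auto
  then show ?thesis using True by (simp add: supp_size_def)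
next
  case False
  then have "{i \<in> {..<Suc n}. (S(n := t)) i \<noteq> 0} = insert n {i \<in> {..<n}. S i \<noteq> 0}" by auto
  then show ?thesis using False by (simp add: supp_size_def)
qed

text \<open>The transform is taken in the last coordinate first. Characters turn the added term of
  the dot product into a factor, and being r-periodic they do not see the reduction modulo r in
  \<open>Zr_dot\<close>.\<close>

lemma fourier_coeff_Suc:
  assumes r: "0 < r"
  shows "fourier_coeff r (Suc n) m f (S(n := t))
    = fourier_coeff r n m (\<lambda>x. char_coeff r m (\<lambda>y. f (x(n := y))) t) S"
proof (rule eq_matI)
  fix i j assume "i < dim_row (fourier_coeff r n m (\<lambda>x. char_coeff r m (\<lambda>y. f (x(n := y))) t) S)"
    "j < dim_col (fourier_coeff r n m (\<lambda>x. char_coeff r m (\<lambda>y. f (x(n := y))) t) S)"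
  then have ij: "i < m" "j < m" by (auto simp: fourier_coeff_def)
  have dot: "omega r powi (- int (Zr_dot r (Suc n) (S(n := t)) (x(n := y))))
      = omega r powi (- int (Zr_dot r n S x)) * unit_char r (t * y)" for x y
    by (simp add: omega_powi Zr_dot_def unit_char_mod[OF r] unit_char_add)
  show "fourier_coeff r (Suc n) m f (S(n := t)) $$ (i, j)
      = fourier_coeff r n m (\<lambda>x. char_coeff r m (\<lambda>y. f (x(n := y))) t) S $$ (i, j)"
    using ij by (simp add: fourier_coeff_def char_coeff_def sum_Zr_power_Suc dot
        sum_distrib_left sum_distrib_right sum_divide_distrib mult_ac)
qed (auto simp: fourier_coeff_def)

text \<open>\<kappa> stands for the square of \<rho>, and both sides are squares of those in the
  theorem. No separate exchange of mixed norms is required, because the one-coordinate inequality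
  already carries the sum over a parameter set.\<close>

lemma schatten_hypercontractive:
  assumes p: "1 \<le> p" "p \<le> 2" and r: "2 \<le> r" and \<kappa>0: "0 \<le> \<kappa>"
    and \<kappa>: "(real r - 1) * \<kappa> \<le> (\<Sum>k<r - 1. (p - 1) ^ Suc k)"
    and f: "\<And>x. x \<in> Zr_power r n \<Longrightarrow> f x \<in> carrier_mat m m"
  shows "(\<Sum>S\<in>Zr_power r n. \<kappa> ^ supp_size n S * schatten_pow p (fourier_coeff r n m f S) powr (2 / p))
    \<le> (1 / real r ^ n * (\<Sum>x\<in>Zr_power r n. schatten_pow p (f x))) powr (2 / p)"
  using f
proof (induction n arbitrary: f)
  case 0
  have Z: "Zr_power r 0 = {\<lambda>_. undefined}" by (simp add: Zr_power_def)
  have "fourier_coeff r 0 m f (\<lambda>_. undefined) = f (\<lambda>_. undefined)"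
    using 0[of "\<lambda>_. undefined"] by (intro eq_matI) (auto simp: fourier_coeff_def Z Zr_dot_def)
  then show ?case by (simp add: Z supp_size_def)
next
  case (Suc n)
  let ?Z = "Zr_power r n"
  have r0: "0 < r" using r by simp
  define F where "F x y = f (x(n := y))" for x y
  have F: "F x y \<in> carrier_mat m m" if "x \<in> ?Z" "y < r" for x y
  proof -
    have "x(n := y) \<in> Zr_power r (Suc n)"
      using that by (auto simp: Zr_power_def PiE_iff extensional_def less_Suc_eq)
    then show ?thesis unfolding F_def by (rule Suc.prems)
  qed
  let ?g = "\<lambda>t x. char_coeff r m (F x) t"
  have "(\<Sum>S\<in>Zr_power r (Suc n). \<kappa> ^ supp_size (Suc n) S * schatten_pow p (fourier_coeff r (Suc n) m f S) powr (2 / p))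
      = (\<Sum>t<r. (if t = 0 then 1 else \<kappa>) * (\<Sum>S\<in>?Z. \<kappa> ^ supp_size n S * schatten_pow p (fourier_coeff r n m (?g t) S) powr (2 / p)))"
    unfolding sum_Zr_power_Suc
    by (subst sum.swap) (auto simp: supp_size_upd fourier_coeff_Suc[OF r0] F_def[abs_def] sum_distrib_left mult_ac intro!: sum.cong)
  \<comment> \<open>The induction hypothesis is used for each fixed frequency t of the last
    coordinate, on the function sending x to its coefficient at t.\<close>
  also have "\<dots> \<le> (\<Sum>t<r. (if t = 0 then 1 else \<kappa>) * (1 / real r ^ n * (\<Sum>x\<in>?Z. schatten_pow p (?g t x))) powr (2 / p))"
    using \<kappa>0 by (intro sum_mono mult_left_mono Suc.IH) auto
  also have "\<dots> = (1 / real r ^ n) powr (2 / p) * (\<Sum>t<r. (if t = 0 then 1 else \<kappa>) * (\<Sum>x\<in>?Z. schatten_pow p (?g t x)) powr (2 / p))"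
    by (simp only: powr_mult sum_distrib_left[of "(1 / real r ^ n) powr (2 / p)"] mult_ac)
  \<comment> \<open>The one-coordinate inequality, with the points of the first n coordinates as
    parameter set.\<close>
  also have "\<dots> \<le> (1 / real r ^ n) powr (2 / p) * ((\<Sum>x\<in>?Z. \<Sum>y<r. schatten_pow p (F x y)) / r) powr (2 / p)"
    by (intro mult_left_mono schatten_pow_one_coordinate[OF p r _ F \<kappa>]) auto
  also have "\<dots> = (1 / real r ^ Suc n * (\<Sum>x\<in>Zr_power r (Suc n). schatten_pow p (f x))) powr (2 / p)"
    by (simp add: sum_Zr_power_Suc F_def mult_ac flip: powr_mult)
  finally show ?case .
qed

text \<open>A geometric sum with ratio p - 1, since 1 - (p - 1) = 2 - p: the square of the bound is
  the mean of the first r - 1 positive powers of p - 1. At p = 2 all of them are 1, in agreement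
  with the limit value.\<close>

lemma rho_bound_square:
  assumes r: "2 \<le> r" and p: "1 \<le> p" "p \<le> 2"
  shows "(real r - 1) * (rho_bound r p)\<^sup>2 = (\<Sum>k<r - 1. (p - 1) ^ Suc k)"
proof (cases "p = 2")
  case True
  then show ?thesis using r by (simp add: rho_bound_def of_nat_diff)
next
  case False
  with p have p2: "p < 2" by simp
  have "(p - 1) ^ (r - 1) \<le> 1" using p by (intro power_le_one) auto
  then have "0 \<le> (p - 1) * (1 - (p - 1) ^ (r - 1)) / ((real r - 1) * (2 - p))"
    using p r by (intro divide_nonneg_nonneg mult_nonneg_nonneg) auto
  then have "(real r - 1) * (rho_bound r p)\<^sup>2 = (p - 1) * ((1 - (p - 1) ^ (r - 1)) / (2 - p))"
    using False r by (simp add: rho_bound_def)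
  also have "(1 - (p - 1) ^ (r - 1)) / (2 - p) = (\<Sum>k<r - 1. (p - 1) ^ k)"
    using p2 sum_gp_strict[of "p - 1" "r - 1"] by simp
  finally show ?thesis by (simp add: sum_distrib_left)
qed

theorem theorem3p5:
  fixes r n m :: nat
    and p \<rho> :: real
    and f :: "(nat \<Rightarrow> nat) \<Rightarrow> complex mat"
  assumes "r \<ge> 2" and "n \<ge> 1" and "m \<ge> 1"
    and "1 \<le> p" and "p \<le> 2"
    and "\<And>x. x \<in> Zr_power r n \<Longrightarrow> f x \<in> carrier_mat m m"
    and "0 \<le> \<rho>" and "\<rho> \<le> rho_bound r p"
  shows "sqrt (\<Sum>S\<in>Zr_power r n.
            \<rho> ^ (2 * supp_size n S) * (schatten_norm p (fourier_coeff r n m f S))\<^sup>2)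
         \<le> (1 / real r ^ n * (\<Sum>x\<in>Zr_power r n. schatten_norm p (f x) powr p)) powr (1 / p)"
proof -
  define Z where "Z = 1 / real r ^ n * (\<Sum>x\<in>Zr_power r n. schatten_norm p (f x) powr p)"
  have "(real r - 1) * \<rho>\<^sup>2 \<le> (real r - 1) * (rho_bound r p)\<^sup>2"
    using assms by (intro mult_left_mono power_mono) auto
  also have "\<dots> = (\<Sum>k<r - 1. (p - 1) ^ Suc k)"
    using assms by (intro rho_bound_square) auto
  finally have "(\<Sum>S\<in>Zr_power r n. (\<rho>\<^sup>2) ^ supp_size n S * schatten_pow p (fourier_coeff r n m f S) powr (2 / p))
    \<le> (1 / real r ^ n * (\<Sum>x\<in>Zr_power r n. schatten_pow p (f x))) powr (2 / p)"
    using assms by (intro schatten_hypercontractive) auto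
  then have "(\<Sum>S\<in>Zr_power r n. \<rho> ^ (2 * supp_size n S) * (schatten_norm p (fourier_coeff r n m f S))\<^sup>2) \<le> Z powr (2 / p)"
    using assms by (simp add: Z_def power_mult schatten_norm_square schatten_norm_powr)
  also have "Z powr (2 / p) = (Z powr (1 / p))\<^sup>2"
    by (simp add: power2_eq_square flip: powr_add)
  finally have "sqrt (\<Sum>S\<in>Zr_power r n. \<rho> ^ (2 * supp_size n S) * (schatten_norm p (fourier_coeff r n m f S))\<^sup>2)
      \<le> sqrt ((Z powr (1 / p))\<^sup>2)"
    by (rule real_sqrt_le_mono)
  then show ?thesis by (simp add: Z_def)
qed

end
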